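(* Suppose that either $-1<\alpha,\beta\le 0$ or $0<\alpha,\beta\le 1$ (both parameters in the same range). Then for every $n\ge2$ the eigenvalues $\lambda$ of the Jacobi Tau discretization of degree $n$ with indices $(\alpha,\beta)$ of the problem $u''=\lambda u$ on $(-1,1)$, $u(\pm1)=0$, are real, negative and distinct (that is, the characteristic polynomial $B_n^{(\alpha,\beta)}(\mu)$ in $\mu=1/\lambda$, defined in the context, has only real, negative and simple zeros).
   Context: $D=d/dx$. For $\alpha,\beta>-1$, the Jacobi polynomial of degree $n$ is $$P_n^{(\alpha,\beta)}(x)=\frac1{2^n}\sum_{k=0}^n\binom{n+\alpha}{k}\binom{n+\beta}{n-k}(x-1)^{n-k}(x+1)^k,$$ where $\binom{a}{k}=a(a-1)\cdots(a-k+1)/k!$. Jacobi polynomials are orthogonal on $(-1,1)$ with weight $W_{\alpha,\beta}(x)=(1-x)^\alpha(1+x)^\beta$. Jacobi Tau discretization of degree $n$: find $\lambda\in\mathbb{C}$ and a nonzero polynomial $u_n$ of degree at most $n$ with $u_n(\pm1)=0$ and $\int_{-1}^1(\lambda u_n-u_n'')\,p\,W_{\alpha,\beta}\,dx=0$ for all polynomials $p$ of degree at most $n-2$. Equivalently $\lambda u_n-u_n''=\tau_0\lambda P_n^{(\alpha,\beta)}+\tau_1\lambda P_{n-1}^{(\alpha,\beta)}$ for constants $\tau_0,\tau_1$. Necessarily $\lambda\neq0$, and $\lambda$ is an eigenvalue if and only if $\mu=1/\lambda$ is a zero of the characteristic polynomial $$B_n^{(\alpha,\beta)}(\mu)=\Omega_n^{(\alpha,\beta)}(\mu)\,\Omega_{n-1}^{(\beta,\alpha)}(\mu)+\Omega_n^{(\beta,\alpha)}(\mu)\,\Omega_{n-1}^{(\alpha,\beta)}(\mu),\qquad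 \Omega_m^{(\alpha,\beta)}(\mu)=\sum_{k=0}^{\lfloor m/2\rfloor}\mu^k\,\big(D^{2k}P_m^{(\alpha,\beta)}\big)(1).$$ *)

theory Defs
  imports "HOL-Analysis.Analysis" "HOL-Computational_Algebra.Polynomial"
begin

definition jacobi_poly :: "nat \<Rightarrow> real \<Rightarrow> real \<Rightarrow> real poly" where
  "jacobi_poly n \<alpha> \<beta> =
     smult (1 / 2 ^ n)
       (\<Sum>k\<le>n. smult (((real n + \<alpha>) gchoose k) * ((real n + \<beta>) gchoose (n - k)))
                 ([:-1, 1:] ^ (n - k) * [:1, 1:] ^ k))"

definition jacobi_weight :: "real \<Rightarrow> real \<Rightarrow> real \<Rightarrow> real" where
  "jacobi_weight \<alpha> \<beta> x = (1 - x) powr \<alpha> * (1 + x) powr \<beta>"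

text \<open>The use of \<open>has_integral\<close> also asserts that the integral exists; for \<open>\<alpha>, \<beta> > -1\<close> and a
  polynomial factor it always does, and it agrees with the Lebesgue integral.\<close>

definition tau_eigenvalue :: "nat \<Rightarrow> real \<Rightarrow> real \<Rightarrow> complex \<Rightarrow> bool" where
  "tau_eigenvalue n \<alpha> \<beta> lam \<longleftrightarrow>
     (\<exists>u :: complex poly. u \<noteq> 0 \<and> degree u \<le> n \<and> poly u 1 = 0 \<and> poly u (-1) = 0 \<and>
        (\<forall>p :: complex poly. degree p \<le> n - 2 \<longrightarrow>
           ((\<lambda>x::real. poly (smult lam u - pderiv (pderiv u)) (of_real x) * poly p (of_real x)
                        * of_real (jacobi_weight \<alpha> \<beta> x)) has_integral 0) {-1<..<1}))"

text \<open>The following are polynomials in the variable \<open>\<mu>\<close>.\<close>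

definition jacobi_Omega :: "nat \<Rightarrow> real \<Rightarrow> real \<Rightarrow> real poly" where
  "jacobi_Omega m \<alpha> \<beta> =
     (\<Sum>k\<le>m div 2. monom (poly ((pderiv ^^ (2 * k)) (jacobi_poly m \<alpha> \<beta>)) 1) k)"

definition tau_char_poly :: "nat \<Rightarrow> real \<Rightarrow> real \<Rightarrow> real poly" where
  "tau_char_poly n \<alpha> \<beta> =
     jacobi_Omega n \<alpha> \<beta> * jacobi_Omega (n - 1) \<beta> \<alpha> +
     jacobi_Omega n \<beta> \<alpha> * jacobi_Omega (n - 1) \<alpha> \<beta>"

end

theory Submission
  imports Defs "HOL-Computational_Algebra.Fundamental_Theorem_Algebra"
begin

text \<open>
  Write \<open>P\<^sub>n\<close> for the Jacobi polynomial and let \<open>\<Phi>\<^sub>n(s) = \<Sum> s\<^sup>k (D\<^sup>k P\<^sub>n)(1)\<close>, whose even part is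
  \<open>\<Omega>\<^sub>n(s\<^sup>2)\<close>. If \<open>\<Phi>\<^sub>n(s) + e \<Phi>\<^sub>n\<^sub>-\<^sub>1(s) = 0\<close>, then \<open>v - s v' = P\<^sub>n + e P\<^sub>n\<^sub>-\<^sub>1\<close> has a polynomial solution
  with \<open>v(1) = 0\<close>. Testing this equation with the conjugate of \<open>s v / (1 - x)\<close> and, for \<open>\<alpha> \<le> 0\<close>, of \<open>v'\<close>
  shows, for \<open>Re s \<ge> 0\<close> and \<open>\<beta> > 0\<close>, that \<open>e\<close> times the conjugate of \<open>s\<close>, respectively \<open>e\<close> itself,
  has negative real part. Thus \<open>\<Phi>\<^sub>n\<close> is stable, and on the positive imaginary axis
  \<open>\<Phi>\<^sub>n / \<Phi>\<^sub>n\<^sub>-\<^sub>1\<close> has positive imaginary part (and positive real part if \<open>\<alpha> \<le> 0\<close>). The range \<open>\<beta> \<le> 0\<close> is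
  reduced to \<open>\<beta> + 1\<close>, because \<open>P\<^sub>n\<close> for \<open>(\<alpha>, \<beta>)\<close> is a positive combination of \<open>P\<^sub>n\<close> and \<open>P\<^sub>n\<^sub>-\<^sub>1\<close> for
  \<open>(\<alpha>, \<beta> + 1)\<close>.

  By the Hermite--Biehler theorem the zeros of \<open>\<Omega>\<^sub>n\<^sub>-\<^sub>1\<close> are negative and simple, and the sign of the
  imaginary part determines the sign of \<open>\<Omega>\<^sub>n\<close> at each of them. So all residues of \<open>\<Omega>\<^sub>n / \<Omega>\<^sub>n\<^sub>-\<^sub>1\<close> are
  negative, and this quotient maps the upper half plane to itself. The same holds for \<open>(\<beta>, \<alpha>)\<close>, hence for
  the sum of the two quotients, whose numerator is the characteristic polynomial.
\<close>

section \<open>Integrals against the Jacobi weight\<close>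

definition jacobi_integral :: "real \<Rightarrow> real \<Rightarrow> real poly \<Rightarrow> real" where
  "jacobi_integral \<alpha> \<beta> p = integral {-1<..<1} (\<lambda>x. poly p x * jacobi_weight \<alpha> \<beta> x)"

lemma jacobi_weight_pos: "x \<in> {-1<..<1} \<Longrightarrow> jacobi_weight \<alpha> \<beta> x > 0"
  by (simp add: jacobi_weight_def)

lemma jacobi_weight_nonneg: "jacobi_weight \<alpha> \<beta> x \<ge> 0"
  by (simp add: jacobi_weight_def)

lemma jacobi_weight_add1_left:
  "x \<in> {-1<..<1} \<Longrightarrow> jacobi_weight (\<alpha> + 1) \<beta> x = (1 - x) * jacobi_weight \<alpha> \<beta> x"
  by (simp add: jacobi_weight_def powr_add)

lemma jacobi_weight_add1_right:
  "x \<in> {-1<..<1} \<Longrightarrow> jacobi_weight \<alpha> (\<beta> + 1) x = (1 + x) * jacobi_weight \<alpha> \<beta> x"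
  by (simp add: jacobi_weight_def powr_add)

text \<open>The substitution x = 2 t - 1 turns the weight into a constant multiple of the integrand
  of the Beta function with arguments \<open>\<beta> + 1\<close> and
  \<open>\<alpha> + 1\<close>.\<close>

lemma jacobi_weight_integrable:
  assumes "\<alpha> > -1" "\<beta> > -1"
  shows "jacobi_weight \<alpha> \<beta> integrable_on {-1<..<1}"
proof -
  let ?f = "\<lambda>t::real. t powr (\<beta> + 1 - 1) * (1 - t) powr (\<alpha> + 1 - 1)"
  have "(?f has_integral Beta (\<beta> + 1) (\<alpha> + 1)) (cbox 0 1)"
    using has_integral_Beta_real[of "\<beta> + 1" "\<alpha> + 1"] assms by simp
  from has_integral_affinity'[OF this, of "1/2" "1/2"]
  have "((\<lambda>x. ?f (x / 2 + 1 / 2)) has_integral (Beta (\<beta> + 1) (\<alpha> + 1) * 2)) {-1..1}"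
    by (simp add: mult.commute)
  then have "(\<lambda>x. ?f (x / 2 + 1 / 2)) integrable_on {-1<..<1}"
    by (auto simp: integrable_on_def has_integral_Icc_iff_Ioo)
  then have "(\<lambda>x. (2 powr \<alpha> * 2 powr \<beta>) * ?f (x / 2 + 1 / 2)) integrable_on {-1<..<1}"
    by (rule integrable_on_mult_right)
  then show ?thesis
  proof (rule integrable_spike[OF _ negligible_empty])
    fix x :: real assume x: "x \<in> {-1<..<1} - {}"
    have "(1 - x) powr \<alpha> = 2 powr \<alpha> * (1 - (x / 2 + 1 / 2)) powr \<alpha>"
      "(1 + x) powr \<beta> = 2 powr \<beta> * (x / 2 + 1 / 2) powr \<beta>"
      using x by (simp_all flip: powr_mult add: right_diff_distrib distrib_left add.commute)
    then show "jacobi_weight \<alpha> \<beta> x = (2 powr \<alpha> * 2 powr \<beta>) * ?f (x / 2 + 1 / 2)"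
      by (simp add: jacobi_weight_def)
  qed
qed

text \<open>Because x W = W - (1 - x) W, a factor x is traded for the weight with
  \<open>\<alpha> + 1\<close>; hence the induction has to keep \<open>\<alpha>\<close>
  arbitrary.\<close>

lemma poly_jacobi_weight_integrable:
  assumes "\<alpha> > -1" "\<beta> > -1"
  shows "(\<lambda>x. poly p x * jacobi_weight \<alpha> \<beta> x) integrable_on {-1<..<1}"
  using assms(1)
proof (induction p arbitrary: \<alpha>)
  case (pCons a p)
  have "(\<lambda>x. a * jacobi_weight \<alpha> \<beta> x + (poly p x * jacobi_weight \<alpha> \<beta> x
          - poly p x * jacobi_weight (\<alpha> + 1) \<beta> x)) integrable_on {-1<..<1}"
    using pCons.prems assms(2)
    by (intro integrable_add integrable_diff pCons.IH integrable_on_mult_right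
          jacobi_weight_integrable) auto
  then show ?case
    by (rule integrable_spike[OF _ negligible_empty])
       (simp add: jacobi_weight_add1_left, simp add: algebra_simps)
qed (simp add: integrable_0)

lemma has_integral_jacobi_integral:
  assumes "\<alpha> > -1" "\<beta> > -1"
  shows "((\<lambda>x. poly p x * jacobi_weight \<alpha> \<beta> x) has_integral jacobi_integral \<alpha> \<beta> p) {-1<..<1}"
  using poly_jacobi_weight_integrable[OF assms] by (simp add: jacobi_integral_def integrable_integral)

lemma jacobi_integral_eqI:
  "\<lbrakk>\<alpha> > -1; \<beta> > -1; ((\<lambda>x. poly p x * jacobi_weight \<alpha> \<beta> x) has_integral I) {-1<..<1}\<rbrakk>
    \<Longrightarrow> jacobi_integral \<alpha> \<beta> p = I"
  using has_integral_jacobi_integral has_integral_unique by blast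

lemma jacobi_integral_0 [simp]: "jacobi_integral \<alpha> \<beta> 0 = 0"
  by (simp add: jacobi_integral_def)

lemma jacobi_integral_smult: "jacobi_integral \<alpha> \<beta> (smult c p) = c * jacobi_integral \<alpha> \<beta> p"
  by (simp add: jacobi_integral_def mult.assoc integral_mult_right)

lemma jacobi_integral_minus: "jacobi_integral \<alpha> \<beta> (- p) = - jacobi_integral \<alpha> \<beta> p"
  using jacobi_integral_smult[of \<alpha> \<beta> "-1" p] by simp

context
  fixes \<alpha> \<beta> :: real
  assumes ab: "\<alpha> > -1" "\<beta> > -1"
begin

lemma jacobi_integral_add:
  "jacobi_integral \<alpha> \<beta> (p + q) = jacobi_integral \<alpha> \<beta> p + jacobi_integral \<alpha> \<beta> q"
  unfolding jacobi_integral_def poly_add distrib_right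
  by (intro integral_add poly_jacobi_weight_integrable ab)

lemma jacobi_integral_diff:
  "jacobi_integral \<alpha> \<beta> (p - q) = jacobi_integral \<alpha> \<beta> p - jacobi_integral \<alpha> \<beta> q"
  unfolding jacobi_integral_def poly_diff left_diff_distrib
  by (intro integral_diff poly_jacobi_weight_integrable ab)

lemmas jacobi_integral_linear =
  jacobi_integral_add jacobi_integral_diff jacobi_integral_smult jacobi_integral_minus

lemma jacobi_integral_nonneg:
  assumes "\<And>x. x \<in> {-1<..<1} \<Longrightarrow> poly p x \<ge> 0"
  shows "jacobi_integral \<alpha> \<beta> p \<ge> 0"
  unfolding jacobi_integral_def
  by (intro integral_nonneg poly_jacobi_weight_integrable ab)
     (use assms in \<open>auto intro!: mult_nonneg_nonneg jacobi_weight_nonneg\<close>)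

lemma jacobi_integral_pos:
  assumes nonneg: "\<And>x. x \<in> {-1<..<1} \<Longrightarrow> poly p x \<ge> 0" and "p \<noteq> 0"
  shows "jacobi_integral \<alpha> \<beta> p > 0"
proof -
  let ?f = "\<lambda>x. poly p x * jacobi_weight \<alpha> \<beta> x"
  have "\<not> {-1<..<1} \<subseteq> {x. poly p x = 0}"
    using finite_subset[OF _ poly_roots_finite[OF \<open>p \<noteq> 0\<close>], of "{-1<..<1}"] infinite_Ioo[of "-1::real" 1]
    by auto
  then obtain c where c: "c \<in> {-1<..<1}" "poly p c \<noteq> 0" by blast
  have fpos: "?f x \<ge> 0" if "x \<in> {-1<..<1}" for x
    using nonneg[OF that] by (intro mult_nonneg_nonneg jacobi_weight_nonneg)
  have cont: "continuous_on {-1<..<1} ?f"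
    unfolding jacobi_weight_def by (intro continuous_intros) auto
  have "jacobi_integral \<alpha> \<beta> p \<noteq> 0"
  proof
    assume "jacobi_integral \<alpha> \<beta> p = 0"
    then have int0: "(?f has_integral 0) {-1<..<1}"
      using has_integral_jacobi_integral[OF ab, of p] by simp
    \<comment> \<open>The midpoints between c and the endpoints bound a compact interval around c
      inside (-1, 1), where the integrand is continuous even if the weight is unbounded near -1 or
      1.\<close>
    define a b where "a = (c - 1) / 2" and "b = (c + 1) / 2"
    have cb: "a < c" "c < b" "{a..b} \<subseteq> {-1<..<1}"
      using c(1) by (auto simp: a_def b_def field_simps)
    have "?f integrable_on {a..b}"
      by (intro integrable_continuous_real continuous_on_subset[OF cont] cb)
    then have i: "(?f has_integral integral {a..b} ?f) (cbox a b)" by auto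
    have "integral {a..b} ?f \<le> 0"
      using has_integral_subset_le[OF cb(3) _ int0] i fpos by auto
    moreover have "integral {a..b} ?f \<ge> 0"
      using cb(3) fpos by (intro integral_nonneg \<open>?f integrable_on {a..b}\<close>) auto
    ultimately have "(?f has_integral 0) (cbox a b)" using i by simp
    then have "?f c = 0"
      using cb c(1) fpos
      by (intro has_integral_0_cbox_imp_0[of a b ?f c] continuous_on_subset[OF cont])
        (auto intro!: fpos)
    with c jacobi_weight_pos[OF c(1)] show False by (metis less_irrefl mult_eq_0_iff)
  qed
  with jacobi_integral_nonneg[OF nonneg] show ?thesis by fastforce
qed

lemma jacobi_integral_shift_right:
  "jacobi_integral \<alpha> (\<beta> + 1) p = jacobi_integral \<alpha> \<beta> ([:1, 1:] * p)"
  unfolding jacobi_integral_def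
  by (intro integral_cong) (simp add: jacobi_weight_add1_right, simp add: algebra_simps)

lemma jacobi_integral_shift_both:
  "jacobi_integral (\<alpha> + 1) (\<beta> + 1) p = jacobi_integral \<alpha> \<beta> ([:1, 0, -1:] * p)"
  unfolding jacobi_integral_def
  by (intro integral_cong)
     (simp add: jacobi_weight_add1_right jacobi_weight_add1_left, simp add: algebra_simps)

text \<open>Integration of the derivative of \<open>(1 - x\<^sup>2) W g\<close>, whose boundary values vanish.\<close>

lemma jacobi_pearson:
  "jacobi_integral \<alpha> \<beta> ([:1, 0, -1:] * pderiv g + [:\<beta> - \<alpha>, - (\<alpha> + \<beta> + 2):] * g) = 0"
proof -
  let ?F = "\<lambda>x. (1 - x) powr (\<alpha> + 1) * (1 + x) powr (\<beta> + 1) * poly g x"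
  let ?p = "[:1, 0, -1:] * pderiv g + [:\<beta> - \<alpha>, - (\<alpha> + \<beta> + 2):] * g"
  have "((\<lambda>x. poly ?p x * jacobi_weight \<alpha> \<beta> x) has_integral (?F 1 - ?F (-1))) {-1..1}"
  proof (rule fundamental_theorem_of_calculus_interior)
    show "continuous_on {-1..1} ?F"
      using ab by (intro continuous_intros continuous_on_powr') auto
  next
    fix x :: real assume x: "x \<in> {-1<..<1}"
    have e: "(1 - x) powr (\<alpha> + 1) = (1 - x) * (1 - x) powr \<alpha>"
      "(1 + x) powr (\<beta> + 1) = (1 + x) * (1 + x) powr \<beta>"
      using x by (auto simp: powr_add)
    have "(?F has_real_derivative
        ((- ((\<alpha> + 1) * (1 - x) powr \<alpha>) * (1 + x) powr (\<beta> + 1)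
          + (1 - x) powr (\<alpha> + 1) * ((\<beta> + 1) * (1 + x) powr \<beta>)) * poly g x
          + (1 - x) powr (\<alpha> + 1) * (1 + x) powr (\<beta> + 1) * poly (pderiv g) x)) (at x)"
      using x by (auto intro!: derivative_eq_intros poly_DERIV simp: algebra_simps)
    also have "((- ((\<alpha> + 1) * (1 - x) powr \<alpha>) * (1 + x) powr (\<beta> + 1)
          + (1 - x) powr (\<alpha> + 1) * ((\<beta> + 1) * (1 + x) powr \<beta>)) * poly g x
          + (1 - x) powr (\<alpha> + 1) * (1 + x) powr (\<beta> + 1) * poly (pderiv g) x)
        = poly ?p x * jacobi_weight \<alpha> \<beta> x"
      unfolding e jacobi_weight_def by (simp add: algebra_simps)
    finally show "(?F has_vector_derivative poly ?p x * jacobi_weight \<alpha> \<beta> x) (at x)"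
      by (simp add: has_real_derivative_iff_has_vector_derivative)
  qed simp
  then show ?thesis
    using ab by (intro jacobi_integral_eqI) (auto simp: has_integral_Icc_iff_Ioo)
qed

end

section \<open>Jacobi polynomials\<close>

lemma poly_ext: "(\<And>x. poly p x = poly q x) \<Longrightarrow> p = q" for p q :: "'a::{comm_ring_1,ring_no_zero_divisors,ring_char_0} poly"
  by (metis ext poly_eq_poly_eq_iff)

lemma gbinomial_Suc_absorb: "real (Suc k) * (a gchoose Suc k) = (a - real k) * (a gchoose k)"
  using gbinomial_mult_1[of a k] by (simp add: algebra_simps)

lemma gbinomial_shift_pos: "\<lbrakk>\<alpha> > -1; k \<le> n\<rbrakk> \<Longrightarrow> ((real n + \<alpha>) gchoose k) > 0"
  unfolding gbinomial_prod_rev by (intro divide_pos_pos prod_pos) auto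

lemma pderiv_sum: "pderiv (sum f A) = (\<Sum>x\<in>A. pderiv (f x))" for f :: "_ \<Rightarrow> real poly"
  using higher_pderiv_sum[of 1 f A] by simp

lemma smult_sum_right: "smult c (sum f A) = (\<Sum>x\<in>A. smult c (f x))"
  by (induction A rule: infinite_finite_induct) (simp_all add: smult_add_right)

text \<open>The operator of Rodrigues' formula: \<open>W jacobi_raise q = D ((1 - x\<^sup>2) W q)\<close>.\<close>

definition jacobi_raise :: "real \<Rightarrow> real \<Rightarrow> real poly \<Rightarrow> real poly" where
  "jacobi_raise \<alpha> \<beta> q = [:1, 0, -1:] * pderiv q + [:\<beta> - \<alpha>, - (\<alpha> + \<beta> + 2):] * q"

lemma jacobi_raise_mult:
  "jacobi_raise \<alpha> \<beta> (p * q) = jacobi_raise \<alpha> \<beta> p * q + [:1, 0, -1:] * p * pderiv q"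
  by (simp add: jacobi_raise_def pderiv_mult algebra_simps)

lemma jacobi_raise_smult: "jacobi_raise \<alpha> \<beta> (smult c p) = smult c (jacobi_raise \<alpha> \<beta> p)"
  by (simp add: jacobi_raise_def pderiv_smult smult_add_right)

lemma jacobi_raise_sum: "jacobi_raise \<alpha> \<beta> (sum f A) = (\<Sum>x\<in>A. jacobi_raise \<alpha> \<beta> (f x))"
  by (simp add: jacobi_raise_def pderiv_sum sum_distrib_left sum.distrib)

text \<open>Both coefficients of the operator split along x - 1 and x + 1: 1 - x^2 = -(x - 1)(x +
  1), and the linear one is -(\<alpha> + 1)(x + 1) - (\<beta> + 1)(x - 1). So a product of powers is
  mapped to its two neighbours only.\<close>

lemma jacobi_raise_basis:
  "jacobi_raise \<alpha> \<beta> ([:-1, 1:] ^ i * [:1, 1:] ^ j) =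
     smult (- (real i + \<alpha> + 1)) ([:-1, 1:] ^ i * [:1, 1:] ^ Suc j)
     - smult (real j + \<beta> + 1) ([:-1, 1:] ^ Suc i * [:1, 1:] ^ j)"
proof -
  have *: "[:c, 1:] * pderiv ([:c, 1:] ^ m) = smult (real m) ([:c, 1:] ^ m)" for c :: real and m
  proof (cases m)
    case (Suc l)
    show ?thesis unfolding Suc pderiv_power_Suc
      by (simp add: pderiv_pCons one_pCons[symmetric] del: mult_pCons_left mult_pCons_right)
  qed simp
  have "poly ([:c, 1:] * pderiv ([:c, 1:] ^ m)) x = poly (smult (real m) ([:c, 1:] ^ m)) x"
    for c x :: real and m by (simp only: *)
  then have **: "(c + x) * poly (pderiv ([:c, 1:] ^ m)) x = real m * (c + x) ^ m"
    for c x :: real and m by (simp add: distrib_right)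
  show ?thesis
  proof (rule poly_ext)
    fix x :: real
    let ?A = "poly (pderiv ([:-1, 1:] ^ i)) x" and ?B = "poly (pderiv ([:1, 1:] ^ j)) x"
    have "poly (jacobi_raise \<alpha> \<beta> ([:-1, 1:] ^ i * [:1, 1:] ^ j)) x
      = (\<beta> - \<alpha> - x * (\<alpha> + \<beta> + 2)) * ((-1 + x) ^ i * (1 + x) ^ j)
        - (1 + x) * (1 + x) ^ j * ((-1 + x) * ?A) - (-1 + x) * (-1 + x) ^ i * ((1 + x) * ?B)"
      unfolding jacobi_raise_def pderiv_mult by (simp add: algebra_simps)
    also have "\<dots> = poly (smult (- (real i + \<alpha> + 1)) ([:-1, 1:] ^ i * [:1, 1:] ^ Suc j)
     - smult (real j + \<beta> + 1) ([:-1, 1:] ^ Suc i * [:1, 1:] ^ j)) x"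
      unfolding ** by (simp add: algebra_simps)
    finally show "poly (jacobi_raise \<alpha> \<beta> ([:-1, 1:] ^ i * [:1, 1:] ^ j)) x = \<dots>" .
  qed
qed

text \<open>One step of Rodrigues' formula. By \<open>jacobi_raise_basis\<close> two neighbouring
  terms contribute at each index k; the absorption identity for binomials gives them the weights k
  and Suc n - k, whose sum does not depend on k.\<close>

lemma jacobi_poly_raise:
  "jacobi_raise \<alpha> \<beta> (jacobi_poly n (\<alpha> + 1) (\<beta> + 1)) =
     smult (- 2 * real (Suc n)) (jacobi_poly (Suc n) \<alpha> \<beta>)"
proof -
  \<comment> \<open>Since n + (\<alpha> + 1) = Suc n + \<alpha>, both polynomials have the same
    upper binomial arguments.\<close>
  define a b where "a = real (Suc n) + \<alpha>" and "b = real (Suc n) + \<beta>"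
  define e :: "nat \<Rightarrow> nat \<Rightarrow> real poly" where "e = (\<lambda>i j. [:-1, 1:] ^ i * [:1, 1:] ^ j)"
  define T where "T = (\<lambda>k. (a gchoose k) * (b gchoose (Suc n - k)))"
  have P: "jacobi_poly n (\<alpha> + 1) (\<beta> + 1)
      = smult (1 / 2 ^ n) (\<Sum>k\<le>n. smult ((a gchoose k) * (b gchoose (n - k))) (e (n - k) k))"
    by (simp add: jacobi_poly_def a_def b_def e_def add_ac)
  have Q: "jacobi_poly (Suc n) \<alpha> \<beta> = smult (1 / 2 ^ Suc n) (\<Sum>k\<le>Suc n. smult (T k) (e (Suc n - k) k))"
    by (simp only: jacobi_poly_def a_def b_def e_def T_def)
  \<comment> \<open>The factor k removes the term k = 0, so nothing is lost in the index
    shift.\<close>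
  have shift1: "(\<Sum>k\<le>Suc n. smult (real k * T k) (e (Suc n - k) k))
     = (\<Sum>k\<le>n. smult ((a gchoose k) * (b gchoose (n - k)) * (real (n - k) + \<alpha> + 1)) (e (n - k) (Suc k)))"
  proof -
    have "real (Suc k) * T (Suc k) = (a gchoose k) * (b gchoose (n - k)) * (real (n - k) + \<alpha> + 1)"
      if "k \<in> {..n}" for k
    proof -
      have "real (Suc k) * T (Suc k) = (real (Suc k) * (a gchoose Suc k)) * (b gchoose (n - k))"
        by (simp add: T_def)
      also have "\<dots> = (a gchoose k) * (b gchoose (n - k)) * (real (n - k) + \<alpha> + 1)"
        unfolding gbinomial_Suc_absorb using that by (simp add: a_def of_nat_diff)
      finally show ?thesis .
    qed
    then show ?thesis
      unfolding sum.atMost_Suc_shift by (simp del: of_nat_Suc of_nat_diff)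
  qed
  \<comment> \<open>Here the factor Suc n - k removes the term k = Suc n.\<close>
  have shift2: "(\<Sum>k\<le>Suc n. smult (real (Suc n - k) * T k) (e (Suc n - k) k))
     = (\<Sum>k\<le>n. smult ((a gchoose k) * (b gchoose (n - k)) * (real k + \<beta> + 1)) (e (Suc (n - k)) k))"
  proof -
    have "smult (real (Suc n - k) * T k) (e (Suc n - k) k)
        = smult ((a gchoose k) * (b gchoose (n - k)) * (real k + \<beta> + 1)) (e (Suc (n - k)) k)"
      if k: "k \<in> {..n}" for k
    proof -
      have "real (Suc n - k) * T k = (real (Suc (n - k)) * (b gchoose Suc (n - k))) * (a gchoose k)"
        using k by (simp add: T_def Suc_diff_le)
      also have "\<dots> = (a gchoose k) * (b gchoose (n - k)) * (real k + \<beta> + 1)"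
        unfolding gbinomial_Suc_absorb using k by (simp add: b_def of_nat_diff)
      finally show ?thesis using k by (simp add: Suc_diff_le)
    qed
    then show ?thesis
      unfolding sum.atMost_Suc by (auto intro!: sum.cong simp del: of_nat_Suc of_nat_diff)
  qed
  have "jacobi_raise \<alpha> \<beta> (jacobi_poly n (\<alpha> + 1) (\<beta> + 1)) = smult (1 / 2 ^ n)
      (\<Sum>k\<le>n. smult ((a gchoose k) * (b gchoose (n - k)))
         (smult (- (real (n - k) + \<alpha> + 1)) (e (n - k) (Suc k))
          - smult (real k + \<beta> + 1) (e (Suc (n - k)) k)))"
    unfolding P jacobi_raise_smult jacobi_raise_sum e_def jacobi_raise_basis ..
  also have "\<dots> = smult (- 1 / 2 ^ n)
      ((\<Sum>k\<le>Suc n. smult (real k * T k) (e (Suc n - k) k))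
       + (\<Sum>k\<le>Suc n. smult (real (Suc n - k) * T k) (e (Suc n - k) k)))"
    unfolding shift1 shift2 sum.distrib[symmetric] smult_sum_right
    by (intro sum.cong refl poly_ext) (simp add: field_simps)
  also have "(\<Sum>k\<le>Suc n. smult (real k * T k) (e (Suc n - k) k))
       + (\<Sum>k\<le>Suc n. smult (real (Suc n - k) * T k) (e (Suc n - k) k))
      = smult (real (Suc n)) (\<Sum>k\<le>Suc n. smult (T k) (e (Suc n - k) k))"
    unfolding sum.distrib[symmetric] smult_sum_right smult_add_left[symmetric] distrib_right[symmetric]
    by (intro sum.cong refl) (simp add: of_nat_diff del: of_nat_Suc)
  also have "smult (- 1 / 2 ^ n) \<dots> = smult (- 2 * real (Suc n)) (jacobi_poly (Suc n) \<alpha> \<beta>)"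
    unfolding Q smult_smult by (rule arg_cong2[where f = smult]) (simp_all add: field_simps)
  finally show ?thesis .
qed

text \<open>Integration by parts through Rodrigues' operator: the integral of
  \<open>jacobi_raise\<close> applied to ?P q vanishes, which moves the derivative onto q while the
  weight gains the factor 1 - x^2. This raises both parameters by one and lowers both degrees, so
  the induction generalizes the parameters.\<close>

lemma jacobi_poly_orthogonal:
  assumes "\<alpha> > -1" "\<beta> > -1" "degree q < n"
  shows "jacobi_integral \<alpha> \<beta> (jacobi_poly n \<alpha> \<beta> * q) = 0"
  using assms
proof (induction n arbitrary: \<alpha> \<beta> q)
  case (Suc n)
  let ?P = "jacobi_poly n (\<alpha> + 1) (\<beta> + 1)"
  note ab = Suc.prems(1,2)
  have "jacobi_integral (\<alpha> + 1) (\<beta> + 1) (?P * pderiv q) = 0"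
  \<comment> \<open>For n = 0 the induction hypothesis is void, since no degree is below 0; there q
    is constant and its derivative vanishes.\<close>
  proof (cases "n = 0")
    case True
    then have "pderiv q = 0" using Suc.prems(3) by (simp add: pderiv_eq_0_iff)
    then show ?thesis by simp
  next
    case False
    then show ?thesis using Suc.prems by (intro Suc.IH) (auto simp: degree_pderiv)
  qed
  then have "jacobi_integral \<alpha> \<beta> ([:1, 0, -1:] * ?P * pderiv q) = 0"
    using ab by (simp only: jacobi_integral_shift_both mult.assoc)
  moreover have "jacobi_integral \<alpha> \<beta> (jacobi_raise \<alpha> \<beta> (?P * q)) = 0"
    unfolding jacobi_raise_def by (rule jacobi_pearson[OF ab])
  ultimately have "jacobi_integral \<alpha> \<beta> (jacobi_raise \<alpha> \<beta> ?P * q) = 0"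
    using ab by (simp only: jacobi_raise_mult jacobi_integral_add add_0_right)
  then show ?case
    by (simp add: jacobi_poly_raise jacobi_integral_smult jacobi_integral_minus del: of_nat_Suc)
qed simp

section \<open>Degree, leading coefficient, reflection, and derivatives at 1\<close>

lemma jacobi_poly_lead:
  assumes "\<alpha> > -1" "\<beta> > -1"
  shows degree_jacobi_poly: "degree (jacobi_poly n \<alpha> \<beta>) = n"
    and lead_coeff_jacobi_poly_pos: "coeff (jacobi_poly n \<alpha> \<beta>) n > 0"
proof -
  let ?e = "\<lambda>k. [:-1, 1:] ^ (n - k) * [:1, 1:] ^ k :: real poly"
  have deg: "degree (?e k) = n" if "k \<le> n" for k
    using that by (simp add: degree_mult_eq degree_power_eq)
  have lc: "lead_coeff (?e k) = 1" for k
    unfolding lead_coeff_mult lead_coeff_power by simp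
  have c1: "coeff (?e k) n = 1" if "k \<le> n" for k
    using that deg lc by metis
  \<comment> \<open>Every product in the sum is monic of degree n, so this coefficient is a sum of
    positive products of binomials.\<close>
  show pos: "coeff (jacobi_poly n \<alpha> \<beta>) n > 0"
    unfolding jacobi_poly_def coeff_smult coeff_sum
    by (intro mult_pos_pos sum_pos) (use assms c1 in \<open>auto intro!: mult_pos_pos gbinomial_shift_pos\<close>)
  have "degree (jacobi_poly n \<alpha> \<beta>) \<le> n"
    unfolding jacobi_poly_def using deg
    by (intro order.trans[OF degree_smult_le] degree_sum_le order.trans[OF degree_smult_le]) auto
  with pos show "degree (jacobi_poly n \<alpha> \<beta>) = n"
    by (intro antisym le_degree) auto
qed

text \<open>The reflection exchanges the factors x - 1 and x + 1 up to sign; reversing the order of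
  summation then exchanges the parameters.\<close>

lemma poly_jacobi_poly_minus:
  "poly (jacobi_poly n \<alpha> \<beta>) (- x) = (-1) ^ n * poly (jacobi_poly n \<beta> \<alpha>) x"
proof -
  have "poly (jacobi_poly n \<alpha> \<beta>) (- x) = 1 / 2 ^ n * (\<Sum>k\<le>n. ((real n + \<alpha>) gchoose k) *
      ((real n + \<beta>) gchoose (n - k)) * ((- 1 - x) ^ (n - k) * (1 - x) ^ k))"
    by (simp add: jacobi_poly_def poly_sum minus_diff_commute)
  also have "(\<Sum>k\<le>n. ((real n + \<alpha>) gchoose k) *
      ((real n + \<beta>) gchoose (n - k)) * ((- 1 - x) ^ (n - k) * (1 - x) ^ k))
    = (\<Sum>k\<le>n. ((real n + \<alpha>) gchoose (n - k)) *
      ((real n + \<beta>) gchoose k) * ((- 1 - x) ^ k * (1 - x) ^ (n - k)))"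
    by (rule sum.reindex_bij_witness[of _ "\<lambda>k. n - k" "\<lambda>k. n - k"]) auto
  also have "\<dots> = (-1) ^ n * (\<Sum>k\<le>n. ((real n + \<beta>) gchoose k) *
      ((real n + \<alpha>) gchoose (n - k)) * ((x - 1) ^ (n - k) * (x + 1) ^ k))"
    unfolding sum_distrib_left
  proof (intro sum.cong refl)
    fix k assume "k \<in> {..n}"
    have "- 1 - x = (-1) * (x + 1)" "1 - x = (-1) * (x - 1)" by simp_all
    then have "(- 1 - x) ^ k * (1 - x) ^ (n - k) = ((-1) * (x + 1)) ^ k * ((-1) * (x - 1)) ^ (n - k)"
      by (simp only:)
    also have "\<dots> = ((-1) ^ k * (-1) ^ (n - k)) * ((x - 1) ^ (n - k) * (x + 1) ^ k)"
      unfolding power_mult_distrib by (simp only: mult_ac)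
    also have "(-1) ^ k * (-1) ^ (n - k) = (-1 :: real) ^ n"
      using \<open>k \<in> {..n}\<close> by (simp flip: power_add)
    finally show "((real n + \<alpha>) gchoose (n - k)) * ((real n + \<beta>) gchoose k)
        * ((- 1 - x) ^ k * (1 - x) ^ (n - k))
      = (-1) ^ n * (((real n + \<beta>) gchoose k) * ((real n + \<alpha>) gchoose (n - k))
        * ((x - 1) ^ (n - k) * (x + 1) ^ k))"
      by (simp only: mult_ac)
  qed
  also have "1 / 2 ^ n * ((-1) ^ n * (\<Sum>k\<le>n. ((real n + \<beta>) gchoose k) *
      ((real n + \<alpha>) gchoose (n - k)) * ((x - 1) ^ (n - k) * (x + 1) ^ k)))
    = (-1) ^ n * poly (jacobi_poly n \<beta> \<alpha>) x"
    by (simp add: jacobi_poly_def poly_sum add.commute)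
  finally show ?thesis .
qed

lemma poly_higher_pderiv_jacobi_minus:
  "poly ((pderiv ^^ j) (jacobi_poly n \<alpha> \<beta>)) (- x)
     = (-1) ^ (n + j) * poly ((pderiv ^^ j) (jacobi_poly n \<beta> \<alpha>)) x"
proof -
  have flip: "(pderiv ^^ j) (pcompose p [:0, -1:]) = smult ((-1) ^ j) (pcompose ((pderiv ^^ j) p) [:0, -1:])"
    for p :: "real poly"
    by (induction j) (simp_all add: pderiv_smult pderiv_pcompose pderiv_pCons)
  have "pcompose (jacobi_poly n \<alpha> \<beta>) [:0, -1:] = smult ((-1) ^ n) (jacobi_poly n \<beta> \<alpha>)"
    by (rule poly_ext) (simp add: poly_pcompose poly_jacobi_poly_minus)
  with flip[of "jacobi_poly n \<alpha> \<beta>"]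
  have "smult ((-1) ^ j) (pcompose ((pderiv ^^ j) (jacobi_poly n \<alpha> \<beta>)) [:0, -1:])
      = smult ((-1) ^ n) ((pderiv ^^ j) (jacobi_poly n \<beta> \<alpha>))"
    by (simp add: higher_pderiv_smult)
  from arg_cong[OF this, of "\<lambda>p. (-1) ^ j * poly p x"] show ?thesis
    by (simp add: poly_pcompose power_add flip: mult.assoc power_mult_distrib)
qed

text \<open>After the shift x -> 1 + x the summands are positive multiples of x^(n-k) (x + 2)^k,
  which have nonnegative coefficients, and the summand k = n has a positive coefficient at every x^j
  with j \<le> n. The derivative at 1 is j! times such a coefficient.\<close>

lemma higher_pderiv_jacobi_1_pos:
  assumes "\<alpha> > -1" "\<beta> > -1" "j \<le> n"
  shows "poly ((pderiv ^^ j) (jacobi_poly n \<alpha> \<beta>)) 1 > 0"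
proof -
  have shift: "(pderiv ^^ j) (pcompose p [:1, 1:]) = pcompose ((pderiv ^^ j) p) [:1, 1:]"
    for p :: "real poly"
    by (induction j) (simp_all add: pderiv_pcompose pderiv_pCons)
  let ?e = "\<lambda>k. [:0, 1:] ^ (n - k) * [:2, 1:] ^ k :: real poly"
  have e: "pcompose (jacobi_poly n \<alpha> \<beta>) [:1, 1:] = smult (1 / 2 ^ n)
      (\<Sum>k\<le>n. smult (((real n + \<alpha>) gchoose k) * ((real n + \<beta>) gchoose (n - k))) (?e k))"
    by (rule poly_ext) (simp add: poly_pcompose jacobi_poly_def poly_sum)
  have mult: "coeff (p * q) i \<ge> 0" if "\<And>i. coeff p i \<ge> 0" "\<And>i. coeff q i \<ge> 0" for p q :: "real poly" and i
    unfolding coeff_mult using that by (intro sum_nonneg mult_nonneg_nonneg)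
  have power: "coeff ([:c, 1:] ^ m) i \<ge> 0" if "c \<ge> 0" for c :: real and m i
  proof (induction m arbitrary: i)
    case (Suc m)
    show ?case unfolding power_Suc using Suc that
      by (intro mult) (auto simp: coeff_pCons split: nat.split)
  qed (simp add: coeff_1)
  have "coeff (?e n) j > 0"
    using assms(3) by (simp add: coeff_linear_poly_power)
  then have "coeff (pcompose (jacobi_poly n \<alpha> \<beta>) [:1, 1:]) j > 0"
    unfolding e coeff_smult coeff_sum using assms
    by (intro mult_pos_pos sum_pos2[of _ n] mult_nonneg_nonneg mult power)
       (auto intro!: gbinomial_shift_pos mult_pos_pos intro: less_imp_le)
  moreover have "poly ((pderiv ^^ j) (jacobi_poly n \<alpha> \<beta>)) 1
      = coeff ((pderiv ^^ j) (pcompose (jacobi_poly n \<alpha> \<beta>) [:1, 1:])) 0"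
    unfolding shift by (simp flip: poly_0_coeff_0 add: poly_pcompose)
  ultimately show ?thesis
    by (simp add: coeff_higher_pderiv flip: pochhammer_fact)
qed

section \<open>Energy estimates for the first-order equation\<close>

text \<open>For degree p \<le> n this is the value at 1 of the inverse of 1 - s D applied to p, as a
  polynomial in s: the Neumann series stops because D is nilpotent on polynomials of bounded
  degree.\<close>

definition deriv_poly_1 :: "nat \<Rightarrow> real poly \<Rightarrow> real poly" where
  "deriv_poly_1 n p = (\<Sum>k\<le>n. monom (poly ((pderiv ^^ k) p) 1) k)"

abbreviation cpoly :: "real poly \<Rightarrow> complex \<Rightarrow> complex" where
  "cpoly p \<equiv> poly (map_poly complex_of_real p)"

section \<open>Real polynomials at complex arguments, and the resolvent of D\<close>

lemma map_poly_of_real_add: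
  "map_poly complex_of_real (p + q) = map_poly complex_of_real p + map_poly complex_of_real q"
  by (rule poly_eqI) (simp add: coeff_map_poly)

lemma map_poly_of_real_diff:
  "map_poly complex_of_real (p - q) = map_poly complex_of_real p - map_poly complex_of_real q"
  by (rule poly_eqI) (simp add: coeff_map_poly)

lemma map_poly_of_real_mult:
  "map_poly complex_of_real (p * q) = map_poly complex_of_real p * map_poly complex_of_real q"
  by (rule poly_eqI) (simp add: coeff_map_poly coeff_mult)

lemma map_poly_of_real_smult:
  "map_poly complex_of_real (smult c p) = smult (complex_of_real c) (map_poly complex_of_real p)"
  by (rule poly_eqI) (simp add: coeff_map_poly)

lemma map_poly_of_real_sum:
  "map_poly complex_of_real (sum f A) = (\<Sum>x\<in>A. map_poly complex_of_real (f x))"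
  by (induction A rule: infinite_finite_induct) (simp_all add: map_poly_of_real_add)

lemma map_poly_of_real_pderiv:
  "map_poly complex_of_real (pderiv p) = pderiv (map_poly complex_of_real p)"
  by (rule poly_eqI) (simp add: coeff_map_poly coeff_pderiv)

lemma cpoly_of_real: "cpoly p (of_real x) = of_real (poly p x)"
  by (induction p) (simp_all add: map_poly_pCons)

lemmas cpoly_simps = map_poly_of_real_add map_poly_of_real_diff map_poly_of_real_mult
  map_poly_of_real_smult map_poly_of_real_sum map_poly_of_real_pderiv

text \<open>Real part of \<open>\<Sum> c s\<^sup>k D\<^sup>k p\<close>, the polynomial solution of \<open>v - s v' = c p\<close>.
  Taking \<open>- \<i> * c\<close> for \<open>c\<close> yields the imaginary part.\<close>

definition Re_resolvent :: "complex \<Rightarrow> complex \<Rightarrow> nat \<Rightarrow> real poly \<Rightarrow> real poly" where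
  "Re_resolvent c s n p = (\<Sum>k\<le>n. smult (Re (c * s ^ k)) ((pderiv ^^ k) p))"

lemma higher_pderiv_degree_less: "degree p < k \<Longrightarrow> (pderiv ^^ k) p = 0"
  for p :: "'a::idom poly"
  by (rule poly_eqI) (simp add: coeff_higher_pderiv coeff_eq_0)

text \<open>The real part of v - s v' = c p, which follows by telescoping, the last term being a
  derivative of order n + 1. The third summand on the left comes from Re (s w) = Re s Re w - Im s Im
  w, with Im w = Re (-i w).\<close>

lemma Re_resolvent_eq:
  assumes "degree p \<le> n"
  shows "Re_resolvent c s n p - smult (Re s) (pderiv (Re_resolvent c s n p))
    + smult (Im s) (pderiv (Re_resolvent (- \<i> * c) s n p)) = smult (Re c) p"
proof -
  have pd: "pderiv (Re_resolvent c s n p) = (\<Sum>k\<le>n. smult (Re (c * s ^ k)) ((pderiv ^^ Suc k) p))" for c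
    unfolding Re_resolvent_def
    by (simp add: pderiv_sum pderiv_smult del: times_complex.sel)
  have "smult (Re s) (pderiv (Re_resolvent c s n p)) - smult (Im s) (pderiv (Re_resolvent (- \<i> * c) s n p))
      = (\<Sum>k\<le>n. smult (Re (c * s ^ Suc k)) ((pderiv ^^ Suc k) p))"
    unfolding pd smult_sum_right sum_subtractf[symmetric] smult_smult smult_diff_left[symmetric]
    by (intro sum.cong refl arg_cong2[where f = smult]) (simp add: algebra_simps)
  moreover have "(\<Sum>k\<le>n. smult (Re (c * s ^ k)) ((pderiv ^^ k) p))
      - (\<Sum>k\<le>n. smult (Re (c * s ^ Suc k)) ((pderiv ^^ Suc k) p))
      = (\<Sum>k\<le>n. smult (Re (c * s ^ k)) ((pderiv ^^ k) p) - smult (Re (c * s ^ Suc k)) ((pderiv ^^ Suc k) p))"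
    by (rule sum_subtractf[symmetric])
  moreover have "\<dots> = smult (Re c) p"
    using assms sum_telescope[of "\<lambda>k. smult (Re (c * s ^ k)) ((pderiv ^^ k) p)" n]
    by (simp add: higher_pderiv_degree_less del: funpow.simps times_complex.sel power_Suc)
  ultimately show ?thesis by (simp add: Re_resolvent_def algebra_simps)
qed

lemma poly_Re_resolvent_1: "poly (Re_resolvent c s n p) 1 = Re (c * cpoly (deriv_poly_1 n p) s)"
proof -
  have "cpoly (deriv_poly_1 n p) s = (\<Sum>k\<le>n. of_real (poly ((pderiv ^^ k) p) 1) * s ^ k)"
    by (simp add: deriv_poly_1_def map_poly_of_real_sum map_poly_monom poly_monom poly_sum)
  then show ?thesis
    by (simp add: Re_resolvent_def poly_sum sum_distrib_left Re_sum algebra_simps)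
qed

text \<open>Integration by parts, obtained from \<open>jacobi_pearson\<close> for the index \<gamma>
  after a factor 1 + x is moved out of the weight. The exponent is written \<gamma> + 1 so that
  differentiating (1 + x)^(\<gamma> + 1) leaves an integrable weight.\<close>

lemma jacobi_integral_first_order:
  assumes "\<alpha> > -1" "\<gamma> > -1"
  shows "jacobi_integral \<alpha> (\<gamma> + 1) ([:1, -1:] * pderiv N)
    = (\<alpha> + 1) * jacobi_integral \<alpha> (\<gamma> + 1) N - (\<gamma> + 1) * jacobi_integral \<alpha> \<gamma> ([:1, -1:] * N)"
proof -
  have "[:1, 1:] * ([:1, -1:] * pderiv N) = ([:1, 0, -1:] * pderiv N + [:\<gamma> - \<alpha>, - (\<alpha> + \<gamma> + 2):] * N)
      + smult (\<alpha> + 1) ([:1, 1:] * N) - smult (\<gamma> + 1) ([:1, -1:] * N)"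
    by (rule poly_ext) (simp add: algebra_simps)
  then show ?thesis
    using jacobi_pearson[OF assms, of N]
    by (simp only: jacobi_integral_shift_right[OF assms] jacobi_integral_linear[OF assms])
qed

lemma div_one_minus:
  fixes v :: "real poly"
  assumes "poly v 1 = 0" "coeff v n = a" "degree v \<le> n" "n \<ge> 1"
  obtains h where "v = [:1, -1:] * h" "degree h < n" "coeff h (n - 1) = - a"
proof -
  from assms(1) obtain g where g: "v = [:-1, 1:] * g"
    by (auto simp: poly_eq_0_iff_dvd elim: dvdE)
  have dg: "degree g < n"
  proof (cases "g = 0")
    case False
    then have "degree v = degree g + 1" unfolding g by (subst degree_mult_eq) auto
    with assms(3) show ?thesis by simp
  qed (use assms(4) in auto)
  have "coeff v n = coeff g (n - 1) - coeff g n"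
    unfolding g using assms(4) by (cases n) simp_all
  with dg assms(2) have "coeff g (n - 1) = a" by (simp add: coeff_eq_0)
  with dg show ?thesis by (intro that[of "- g"]) (simp_all add: g)
qed

text \<open>P and Q model the Jacobi polynomials of degrees n and n - 1 for the indices (\<alpha>,
  \<gamma> + 1). They enter only through degrees, the sign of a leading coefficient, and
  orthogonality; \<kappa> will be \<open>jacobi_kappa\<close>.\<close>

context
  fixes \<alpha> \<gamma> \<kappa> :: real and n :: nat and P Q :: "real poly" and s e :: complex
  assumes \<alpha>: "\<alpha> > -1" and \<gamma>: "\<gamma> > -1" and \<kappa>: "\<kappa> > 0" and n: "n \<ge> 1"
    and P: "degree P = n" "coeff P n > 0" and Q: "degree Q < n"
    and orthP: "\<And>q. degree q < n \<Longrightarrow> jacobi_integral \<alpha> (\<gamma> + 1) (P * q) = 0"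
    and orthQ: "\<And>q. degree q < n \<Longrightarrow> jacobi_integral \<alpha> (\<gamma> + 1) (Q * q) = \<kappa> * coeff q (n - 1)"
    and s: "Re s \<ge> 0" "s \<noteq> 0"
    and zero: "cpoly (deriv_poly_1 n P) s + e * cpoly (deriv_poly_1 n Q) s = 0"
begin

text \<open>Let v = v1 + i v2 be the resolvent of P + e Q. By \<open>zero\<close> it vanishes at 1,
  so v = (1 - x) h with h = h1 + i h2. The two equations are the real and imaginary parts of v - s
  v' = P + e Q.\<close>

lemma resolvent_solution:
  obtains h1 h2 where
    "[:1, -1:] * h1 - smult (Re s) (pderiv ([:1, -1:] * h1)) + smult (Im s) (pderiv ([:1, -1:] * h2))
       = P + smult (Re e) Q"
    "[:1, -1:] * h2 - smult (Re s) (pderiv ([:1, -1:] * h2)) - smult (Im s) (pderiv ([:1, -1:] * h1))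
       = smult (Im e) Q"
    "degree h1 < n" "degree h2 < n" "coeff h1 (n - 1) = - coeff P n" "coeff h2 (n - 1) = 0"
proof -
  define v1 where "v1 = Re_resolvent 1 s n P + Re_resolvent e s n Q"
  define v2 where "v2 = Re_resolvent (- \<i>) s n P + Re_resolvent (- \<i> * e) s n Q"
  have minus: "Re_resolvent (- c) s n p = - Re_resolvent c s n p" for c p
    by (simp add: Re_resolvent_def flip: sum_negf smult_minus_left)
  have A: "v1 - smult (Re s) (pderiv v1) + smult (Im s) (pderiv v2) = P + smult (Re e) Q"
    using Re_resolvent_eq[of P n 1 s] Re_resolvent_eq[of Q n e s] P(1) Q
    by (simp add: v1_def v2_def pderiv_add smult_add_right algebra_simps)
  have B: "v2 - smult (Re s) (pderiv v2) - smult (Im s) (pderiv v1) = smult (Im e) Q"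
    using Re_resolvent_eq[of P n "- \<i>" s] Re_resolvent_eq[of Q n "- \<i> * e" s] P(1) Q
    by (simp add: v1_def v2_def pderiv_add smult_add_right pderiv_minus pderiv_diff smult_diff_right minus algebra_simps)
  have deg: "degree (Re_resolvent c s n p) \<le> n" if "degree p \<le> n" for c p
    unfolding Re_resolvent_def
    by (intro degree_sum_le order.trans[OF degree_smult_le]) (use that in \<open>auto simp: degree_higher_pderiv\<close>)
  have d1: "degree v1 \<le> n" and d2: "degree v2 \<le> n"
    unfolding v1_def v2_def by (intro degree_add_le deg; use P(1) Q in simp)+
  have dv: "coeff (pderiv v1) n = 0" "coeff (pderiv v2) n = 0"
    using d1 d2 by (simp_all add: coeff_pderiv coeff_eq_0)
  \<comment> \<open>In degree n neither the derivatives nor Q contribute, so v has the same top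
    coefficient as P.\<close>
  have c1: "coeff v1 n = coeff P n" and c2: "coeff v2 n = 0"
    using arg_cong[OF A, of "\<lambda>p. coeff p n"] arg_cong[OF B, of "\<lambda>p. coeff p n"] dv Q
    by (simp_all add: coeff_eq_0)
  have "poly v1 1 = Re (cpoly (deriv_poly_1 n P) s + e * cpoly (deriv_poly_1 n Q) s)"
    by (simp only: v1_def poly_add poly_Re_resolvent_1 plus_complex.sel mult_1)
  then have z1: "poly v1 1 = 0" using zero by simp
  have "poly v2 1 = Re (- \<i> * (cpoly (deriv_poly_1 n P) s + e * cpoly (deriv_poly_1 n Q) s))"
    by (simp only: v2_def poly_add poly_Re_resolvent_1 plus_complex.sel distrib_left mult.assoc)
  then have z2: "poly v2 1 = 0" unfolding zero by simp
  obtain h1 where h1: "v1 = [:1, -1:] * h1" "degree h1 < n" "coeff h1 (n - 1) = - coeff P n"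
    using div_one_minus[OF z1 c1 d1 n] by blast
  obtain h2 where h2: "v2 = [:1, -1:] * h2" "degree h2 < n" "coeff h2 (n - 1) = - 0"
    using div_one_minus[OF z2 c2 d2 n] by blast
  show ?thesis
    by (rule that[of h1 h2]) (use A B h1 h2 in simp_all)
qed

text \<open>Pair v - s v' = P + e Q with the conjugate of s h. Orthogonality removes P and reduces
  the right side to a negative multiple of Re (e cnj s); on the left, integration by parts gives a
  positive quantity when \<alpha> \<le> 1.\<close>

lemma stability_inequality_conj:
  assumes "\<alpha> \<le> 1"
  shows "Re (e * cnj s) < 0"
proof -
  let ?L = "jacobi_integral \<alpha> (\<gamma> + 1)" and ?M = "jacobi_integral \<alpha> \<gamma>"
  have g1: "\<gamma> + 1 > -1" using \<gamma> by simp
  note lin = jacobi_integral_linear[OF \<alpha> g1]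
  obtain h1 h2 where A: "[:1, -1:] * h1 - smult (Re s) (pderiv ([:1, -1:] * h1))
      + smult (Im s) (pderiv ([:1, -1:] * h2)) = P + smult (Re e) Q"
    and B: "[:1, -1:] * h2 - smult (Re s) (pderiv ([:1, -1:] * h2))
      - smult (Im s) (pderiv ([:1, -1:] * h1)) = smult (Im e) Q"
    and h: "degree h1 < n" "degree h2 < n" "coeff h1 (n - 1) = - coeff P n" "coeff h2 (n - 1) = 0"
    by (rule resolvent_solution)
  define N where "N = h1 * h1 + h2 * h2"
  \<comment> \<open>q1 + i q2 = s h, and N above is the squared modulus of h.\<close>
  define q1 q2 where "q1 = smult (Re s) h1 - smult (Im s) h2" and "q2 = smult (Im s) h1 + smult (Re s) h2"
  have deg: "degree q1 < n" "degree q2 < n"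
    using h n unfolding q1_def q2_def
    by (auto intro!: degree_diff_less degree_add_less order.strict_trans1[OF degree_smult_le])
  have "h1 \<noteq> 0" using h(3) P(2) by auto
  have Npos: "poly N x \<ge> 0" for x by (simp add: N_def)
  have "N \<noteq> 0"
  proof
    assume "N = 0"
    have "poly h1 x = 0" for x
      using arg_cong[OF \<open>N = 0\<close>, of "\<lambda>p. poly p x"] by (simp add: N_def sum_squares_eq_zero_iff)
    with \<open>h1 \<noteq> 0\<close> show False using poly_all_0_iff_0 by blast
  qed
  have LN: "?L N > 0"
    using jacobi_integral_pos[OF \<alpha> g1] Npos \<open>N \<noteq> 0\<close> by blast
  have MN: "?M ([:1, -1:] * N) > 0"
  proof (rule jacobi_integral_pos[OF \<alpha> \<gamma>])
    show "[:1, -1:] * N \<noteq> 0" using \<open>N \<noteq> 0\<close> by (simp del: mult_pCons_left)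
    show "poly ([:1, -1:] * N) x \<ge> 0" if "x \<in> {-1<..<1}" for x
      using that Npos[of x] by (simp add: mult_nonneg_nonneg left_diff_distrib[symmetric] del: mult_pCons_left)
  qed
  \<comment> \<open>The real part of (v - s v') cnj (s h), using v' = -h + (1 - x) h'.\<close>
  have "(P + smult (Re e) Q) * q1 + smult (Im e) Q * q2
      = smult (Re s) ([:1, -1:] * N)
        + smult ((Re s)\<^sup>2 + (Im s)\<^sup>2) (N - smult (1/2) ([:1, -1:] * pderiv N))"
    unfolding A[symmetric] B[symmetric] N_def q1_def q2_def
    by (rule poly_ext) (simp add: pderiv_add pderiv_mult pderiv_pCons pderiv_minus pderiv_diff algebra_simps power2_eq_square)
  from arg_cong[OF this, of ?L]
  have "?L (P * q1) + Re e * ?L (Q * q1) + Im e * ?L (Q * q2)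
      = Re s * ?L ([:1, -1:] * N)
        + ((Re s)\<^sup>2 + (Im s)\<^sup>2) * (?L N - 1 / 2 * ?L ([:1, -1:] * pderiv N))"
    by (simp only: lin distrib_right mult_smult_left)
  moreover have "?L (P * q1) + Re e * ?L (Q * q1) + Im e * ?L (Q * q2) = - (\<kappa> * coeff P n) * Re (e * cnj s)"
    using orthP[OF deg(1)] orthQ[OF deg(1)] orthQ[OF deg(2)] h(3,4)
    by (simp add: q1_def q2_def algebra_simps)
  moreover have "Re s * ?L ([:1, -1:] * N) \<ge> 0"
  proof (intro mult_nonneg_nonneg s jacobi_integral_nonneg[OF \<alpha> g1])
    show "poly ([:1, -1:] * N) x \<ge> 0" if "x \<in> {-1<..<1}" for x
      using that Npos[of x] by (simp add: mult_nonneg_nonneg left_diff_distrib[symmetric] del: mult_pCons_left)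
  qed
  \<comment> \<open>Integration by parts leaves the factor (1 - \<alpha>) / 2 at the integral of N,
    which is where \<alpha> \<le> 1 enters; \<gamma> > -1 makes the second term strictly
    positive.\<close>
  moreover have "?L N - 1 / 2 * ?L ([:1, -1:] * pderiv N)
      = (1 - \<alpha>) / 2 * ?L N + (\<gamma> + 1) / 2 * ?M ([:1, -1:] * N)"
    unfolding jacobi_integral_first_order[OF \<alpha> \<gamma>] by (simp add: field_simps)
  moreover have "\<dots> > 0"
    using assms \<gamma> LN MN by (intro add_nonneg_pos mult_pos_pos mult_nonneg_nonneg) auto
  moreover have "(Re s)\<^sup>2 + (Im s)\<^sup>2 > 0"
    using s(2) by (simp add: complex_eq_iff sum_power2_gt_zero_iff)
  ultimately have "- (\<kappa> * coeff P n) * Re (e * cnj s) > 0"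
    by (metis add_nonneg_pos mult_pos_pos)
  then have "(\<kappa> * coeff P n) * Re (e * cnj s) < 0"
    by (metis mult_minus_left neg_0_less_iff_less)
  then show ?thesis
    using mult_pos_pos[OF \<kappa> P(2)] by (metis mult_less_cancel_left_pos mult_zero_right)
qed

text \<open>Now the test function is the conjugate of v', of degree below n and with top coefficient
  n times that of P. The term v cnj v' contributes half the derivative of the squared modulus of v,
  whose integral is negative for \<alpha> \<le> 0.\<close>

lemma stability_inequality:
  assumes "\<alpha> \<le> 0"
  shows "Re e < 0"
proof -
  let ?L = "jacobi_integral \<alpha> (\<gamma> + 1)" and ?M = "jacobi_integral \<alpha> \<gamma>"
  have g1: "\<gamma> + 1 > -1" using \<gamma> by simp
  note lin = jacobi_integral_linear[OF \<alpha> g1]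
  obtain h1 h2 where A: "[:1, -1:] * h1 - smult (Re s) (pderiv ([:1, -1:] * h1))
      + smult (Im s) (pderiv ([:1, -1:] * h2)) = P + smult (Re e) Q"
    and B: "[:1, -1:] * h2 - smult (Re s) (pderiv ([:1, -1:] * h2))
      - smult (Im s) (pderiv ([:1, -1:] * h1)) = smult (Im e) Q"
    and h: "degree h1 < n" "degree h2 < n" "coeff h1 (n - 1) = - coeff P n" "coeff h2 (n - 1) = 0"
    by (rule resolvent_solution)
  define v1 v2 where "v1 = [:1, -1:] * h1" and "v2 = [:1, -1:] * h2"
  \<comment> \<open>(1 - x) U is the squared modulus of v; splitting off one factor 1 - x prepares
    for \<open>jacobi_integral_first_order\<close>.\<close>
  define U where "U = [:1, -1:] * (h1 * h1 + h2 * h2)"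
  note AB = A[folded v1_def v2_def] B[folded v1_def v2_def]
  have deg: "degree (pderiv v) < n" "coeff (pderiv v) (n - 1) = - real n * coeff k (n - 1)"
    if "v = [:1, -1:] * k" "degree k < n" for v k
  proof -
    have "degree v \<le> n"
      unfolding that(1) using that(2) by (intro order.trans[OF degree_mult_le]) simp
    then show "degree (pderiv v) < n" using n by (simp add: degree_pderiv)
    show "coeff (pderiv v) (n - 1) = - real n * coeff k (n - 1)"
      using that n by (cases n) (simp_all add: coeff_pderiv coeff_eq_0 algebra_simps)
  qed
  note d1 = deg[OF v1_def h(1)] and d2 = deg[OF v2_def h(2)]
  have "h1 \<noteq> 0" using h(3) P(2) by auto
  have Upos: "poly U x \<ge> 0" if "x \<in> {-1<..<1}" for x
  proof -
    have "poly U x = (1 - x) * ((poly h1 x)\<^sup>2 + (poly h2 x)\<^sup>2)"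
      by (simp add: U_def algebra_simps power2_eq_square)
    with that show ?thesis by simp
  qed
  have "U \<noteq> 0"
  proof
    assume "U = 0"
    then have N0: "h1 * h1 + h2 * h2 = 0" by (simp add: U_def del: mult_pCons_left)
    have "poly h1 x = 0" for x
      using arg_cong[OF N0, of "\<lambda>p. poly p x"] by (simp add: sum_squares_eq_zero_iff)
    with \<open>h1 \<noteq> 0\<close> show False using poly_all_0_iff_0 by blast
  qed
  have MU1: "?M ([:1, -1:] * U) > 0"
  proof (rule jacobi_integral_pos[OF \<alpha> \<gamma>])
    show "[:1, -1:] * U \<noteq> 0" using \<open>U \<noteq> 0\<close> by (simp del: mult_pCons_left)
    show "poly ([:1, -1:] * U) x \<ge> 0" if "x \<in> {-1<..<1}" for x
      using that Upos[OF that] by (simp add: mult_nonneg_nonneg left_diff_distrib[symmetric] del: mult_pCons_left)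
  qed
  have MU2: "?M ([:1, 1:] * U) \<ge> 0"
  proof (rule jacobi_integral_nonneg[OF \<alpha> \<gamma>])
    show "poly ([:1, 1:] * U) x \<ge> 0" if "x \<in> {-1<..<1}" for x
      using that Upos[OF that] by (simp add: mult_nonneg_nonneg distrib_right[symmetric] del: mult_pCons_left)
  qed
  have "(P + smult (Re e) Q) * pderiv v1 + smult (Im e) Q * pderiv v2
      = smult (1/2) (pderiv ([:1, -1:] * U))
        - smult (Re s) (pderiv v1 * pderiv v1 + pderiv v2 * pderiv v2)"
    unfolding AB[symmetric] unfolding v1_def v2_def U_def
    by (rule poly_ext) (simp add: pderiv_add pderiv_mult pderiv_pCons pderiv_minus pderiv_diff algebra_simps)
  from arg_cong[OF this, of ?L]
  have "?L (P * pderiv v1) + Re e * ?L (Q * pderiv v1) + Im e * ?L (Q * pderiv v2)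
      = 1 / 2 * ?L (pderiv ([:1, -1:] * U))
        - Re s * ?L (pderiv v1 * pderiv v1 + pderiv v2 * pderiv v2)"
    by (simp only: lin distrib_right mult_smult_left)
  moreover have "?L (P * pderiv v1) + Re e * ?L (Q * pderiv v1) + Im e * ?L (Q * pderiv v2)
      = (\<kappa> * real n * coeff P n) * Re e"
    using orthP[OF d1(1)] orthQ[OF d1(1)] orthQ[OF d2(1)] d1(2) d2(2) h(3,4) by simp
  moreover have "Re s * ?L (pderiv v1 * pderiv v1 + pderiv v2 * pderiv v2) \<ge> 0"
    by (intro mult_nonneg_nonneg s jacobi_integral_nonneg[OF \<alpha> g1]) simp
  \<comment> \<open>Differentiating the factor 1 - x subtracts one integral of U and thus lowers the
    coefficient \<alpha> + 1 to \<alpha>. This explains the stronger condition \<alpha> \<le>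
    0.\<close>
  moreover have "?L (pderiv ([:1, -1:] * U)) = \<alpha> * ?M ([:1, 1:] * U) - (\<gamma> + 1) * ?M ([:1, -1:] * U)"
  proof -
    have *: "pderiv ([:1, -1:] * U) = [:1, -1:] * pderiv U - U"
      unfolding pderiv_mult by (simp add: pderiv_pCons algebra_simps)
    show ?thesis
      unfolding * lin jacobi_integral_first_order[OF \<alpha> \<gamma>] jacobi_integral_shift_right[OF \<alpha> \<gamma>, of U]
      by (simp add: algebra_simps del: mult_pCons_left)
  qed
  moreover have "\<alpha> * ?M ([:1, 1:] * U) \<le> 0"
    using assms MU2 by (simp add: mult_nonpos_nonneg)
  moreover have "(\<gamma> + 1) * ?M ([:1, -1:] * U) > 0"
    using \<gamma> MU1 by simp
  ultimately have "(\<kappa> * real n * coeff P n) * Re e < 0" by linarith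
  moreover have "\<kappa> * real n * coeff P n > 0" using \<kappa> n P by simp
  ultimately show ?thesis by (metis mult_less_cancel_left_pos mult_zero_right)
qed

end

section \<open>Stability\<close>

lemma degree_less_or_0: "\<lbrakk>degree p \<le> m; coeff p m = 0\<rbrakk> \<Longrightarrow> p = 0 \<or> degree p < m"
  by (metis le_neq_implies_less leading_coeff_0_iff)

lemma jacobi_integral_self_pos:
  assumes "\<alpha> > -1" "\<beta> > -1" "p \<noteq> 0"
  shows "jacobi_integral \<alpha> \<beta> (p * p) > 0"
  using assms by (intro jacobi_integral_pos) auto

lemma jacobi_poly_nonzero: "\<alpha> > -1 \<Longrightarrow> \<beta> > -1 \<Longrightarrow> jacobi_poly n \<alpha> \<beta> \<noteq> 0"
  using lead_coeff_jacobi_poly_pos[of \<alpha> \<beta> n] by auto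

text \<open>Integration against P_n of a polynomial of degree at most n sees only its coefficient at
  x^n, and this is the proportionality factor (\<open>jacobi_integral_lead\<close>).\<close>

definition jacobi_kappa :: "nat \<Rightarrow> real \<Rightarrow> real \<Rightarrow> real" where
  "jacobi_kappa n \<alpha> \<beta> = jacobi_integral \<alpha> \<beta> (jacobi_poly n \<alpha> \<beta> * jacobi_poly n \<alpha> \<beta>)
     / coeff (jacobi_poly n \<alpha> \<beta>) n"

lemma jacobi_kappa_pos: "\<alpha> > -1 \<Longrightarrow> \<beta> > -1 \<Longrightarrow> jacobi_kappa n \<alpha> \<beta> > 0"
  unfolding jacobi_kappa_def
  by (intro divide_pos_pos jacobi_integral_self_pos jacobi_poly_nonzero lead_coeff_jacobi_poly_pos)

lemma jacobi_integral_lead: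
  assumes ab: "\<alpha> > -1" "\<beta> > -1" and q: "degree q \<le> n"
  shows "jacobi_integral \<alpha> \<beta> (jacobi_poly n \<alpha> \<beta> * q) = jacobi_kappa n \<alpha> \<beta> * coeff q n"
proof -
  let ?P = "jacobi_poly n \<alpha> \<beta>"
  define r where "r = q - smult (coeff q n / coeff ?P n) ?P"
  have "degree r \<le> n" "coeff r n = 0"
    using q degree_jacobi_poly[OF ab, of n] lead_coeff_jacobi_poly_pos[OF ab, of n]
    by (auto simp: r_def intro!: degree_diff_le order.trans[OF degree_smult_le])
  then have "jacobi_integral \<alpha> \<beta> (?P * r) = 0"
    using degree_less_or_0 jacobi_poly_orthogonal[OF ab] by (metis jacobi_integral_0 mult_zero_right)
  moreover have "?P * q = ?P * r + smult (coeff q n / coeff ?P n) (?P * ?P)"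
    by (simp add: r_def algebra_simps)
  ultimately show ?thesis
    by (simp add: jacobi_integral_linear[OF ab] jacobi_kappa_def)
qed

text \<open>Subtracting the multiple of ?R that cancels the leading term leaves r of degree below n.
  Against the shifted weight, r is orthogonal to all degrees below n - 1, so it is a multiple of ?S;
  testing with ?S shows that the factor is positive.\<close>

lemma jacobi_poly_shift_right:
  assumes \<alpha>: "\<alpha> > -1" and \<gamma>: "\<gamma> > -1" and n: "n \<ge> 1"
  obtains x c where "x > 0" "c > 0"
    "jacobi_poly n \<alpha> \<gamma> = smult x (jacobi_poly n \<alpha> (\<gamma> + 1) + smult c (jacobi_poly (n - 1) \<alpha> (\<gamma> + 1)))"
proof -
  have g1: "\<gamma> + 1 > -1" using \<gamma> by simp
  let ?P = "jacobi_poly n \<alpha> \<gamma>" and ?R = "jacobi_poly n \<alpha> (\<gamma> + 1)" and ?S = "jacobi_poly (n - 1) \<alpha> (\<gamma> + 1)"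
  let ?L = "jacobi_integral \<alpha> (\<gamma> + 1)"
  note lin = jacobi_integral_linear[OF \<alpha> g1]
  define x where "x = coeff ?P n / coeff ?R n"
  define r where "r = ?P - smult x ?R"
  define c where "c = coeff r (n - 1) / coeff ?S (n - 1)"
  define t where "t = r - smult c ?S"
  have x: "x > 0"
    unfolding x_def by (intro divide_pos_pos lead_coeff_jacobi_poly_pos \<alpha> \<gamma> g1)
  have "degree r \<le> n" "coeff r n = 0"
    using lead_coeff_jacobi_poly_pos[OF \<alpha> g1, of n]
    by (auto simp: r_def x_def degree_jacobi_poly \<alpha> \<gamma> g1
        intro!: degree_diff_le order.trans[OF degree_smult_le])
  then have dr: "degree r \<le> n - 1" using degree_less_or_0[of r n] n by auto
  have "degree t \<le> n - 1" "coeff t (n - 1) = 0"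
    using lead_coeff_jacobi_poly_pos[OF \<alpha> g1, of "n - 1"] dr
    by (auto simp: t_def c_def degree_jacobi_poly \<alpha> \<gamma> g1
        intro!: degree_diff_le order.trans[OF degree_smult_le])
  then have dt: "t = 0 \<or> degree t < n - 1" by (rule degree_less_or_0)
  \<comment> \<open>The extra factor 1 + x of the shifted weight is absorbed into q, whose degree
    becomes at most n; so only the top coefficient of q survives.\<close>
  have Lr: "?L (r * q) = jacobi_kappa n \<alpha> \<gamma> * coeff q (n - 1)" if "degree q < n" for q
  proof -
    have "?L (r * q) = ?L (?P * q) - x * ?L (?R * q)"
      by (simp add: r_def left_diff_distrib lin)
    also have "?L (?R * q) = 0" using that by (intro jacobi_poly_orthogonal \<alpha> g1)
    also have "?L (?P * q) = jacobi_integral \<alpha> \<gamma> (?P * ([:1, 1:] * q))"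
      by (simp only: jacobi_integral_shift_right[OF \<alpha> \<gamma>] mult_ac)
    also have "\<dots> = jacobi_kappa n \<alpha> \<gamma> * coeff ([:1, 1:] * q) n"
      using that n by (intro jacobi_integral_lead \<alpha> \<gamma> order.trans[OF degree_mult_le]) simp
    also have "coeff ([:1, 1:] * q) n = coeff q (n - 1)"
      using that n by (cases n) (simp_all add: coeff_eq_0)
    finally show ?thesis by simp
  qed
  \<comment> \<open>t = r - c ?S is orthogonal to both r and ?S, hence to itself.\<close>
  have "?L (r * t) = 0"
  proof (cases "t = 0")
    case False
    with dt have "degree t < n - 1" by simp
    then show ?thesis by (simp add: Lr coeff_eq_0)
  qed simp
  moreover have "?L (?S * t) = 0"
    using dt jacobi_poly_orthogonal[OF \<alpha> g1, of t "n - 1"] by auto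
  moreover have "?L (t * t) = ?L (r * t) - c * ?L (?S * t)"
    by (simp add: t_def left_diff_distrib lin)
  ultimately have "t = 0"
    using jacobi_integral_self_pos[OF \<alpha> g1, of t] by fastforce
  then have r: "r = smult c ?S" by (simp add: t_def)
  have "?L (r * ?S) > 0"
    using n by (simp add: Lr degree_jacobi_poly jacobi_kappa_pos lead_coeff_jacobi_poly_pos \<alpha> \<gamma> g1)
  then have c: "c > 0"
    using jacobi_integral_self_pos[OF \<alpha> g1 jacobi_poly_nonzero[OF \<alpha> g1, of "n - 1"]]
    unfolding r by (simp add: lin zero_less_mult_iff)
  show ?thesis
  proof (rule that[of x "c / x"])
    have "?P = smult x ?R + r" by (simp add: r_def)
    then show "?P = smult x (?R + smult (c / x) ?S)"
      using x by (simp add: r smult_add_right)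
  qed (use x c in auto)
qed

section \<open>Stability of Phi and the ratio of consecutive degrees\<close>

definition jacobi_Phi :: "nat \<Rightarrow> real \<Rightarrow> real \<Rightarrow> real poly" where
  "jacobi_Phi n \<alpha> \<beta> = deriv_poly_1 n (jacobi_poly n \<alpha> \<beta>)"

lemma deriv_poly_1_extend:
  assumes "degree p \<le> m" "m \<le> n"
  shows "deriv_poly_1 n p = deriv_poly_1 m p"
  unfolding deriv_poly_1_def using assms
  by (intro sum.mono_neutral_right) (auto simp: higher_pderiv_degree_less)

lemma deriv_poly_1_add: "deriv_poly_1 n (p + q) = deriv_poly_1 n p + deriv_poly_1 n q"
  by (simp add: deriv_poly_1_def higher_pderiv_add add_monom[symmetric] sum.distrib)

lemma deriv_poly_1_smult: "deriv_poly_1 n (smult c p) = smult c (deriv_poly_1 n p)"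
  by (simp add: deriv_poly_1_def higher_pderiv_smult smult_sum_right smult_monom)

lemma cpoly_0: "cpoly p 0 = of_real (coeff p 0)"
  by (simp add: poly_0_coeff_0 coeff_map_poly)

lemma cpoly_jacobi_Phi_0: 
  assumes "\<alpha> > -1" "\<beta> > -1"
  shows "cpoly (jacobi_Phi n \<alpha> \<beta>) 0 \<noteq> 0"
proof -
  have "coeff (jacobi_Phi n \<alpha> \<beta>) 0 = poly (jacobi_poly n \<alpha> \<beta>) 1"
    by (simp add: jacobi_Phi_def deriv_poly_1_def coeff_sum)
  with higher_pderiv_jacobi_1_pos[OF assms, of 0 n] show ?thesis
    by (simp add: cpoly_0)
qed

lemma jacobi_poly_0: "jacobi_poly 0 \<alpha> \<beta> = 1"
  by (simp add: jacobi_poly_def)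

lemma cpoly_jacobi_Phi_degree_0: "cpoly (jacobi_Phi 0 \<alpha> \<beta>) s = 1"
  by (simp add: jacobi_Phi_def deriv_poly_1_def jacobi_poly_0 monom_0 map_poly_pCons)

lemma jacobi_Phi_inequalities:
  assumes \<alpha>: "\<alpha> > -1" and \<gamma>: "\<gamma> > -1" and n: "n \<ge> 1" and s: "Re s \<ge> 0" "s \<noteq> 0"
    and zero: "cpoly (jacobi_Phi n \<alpha> (\<gamma> + 1)) s + e * cpoly (jacobi_Phi (n - 1) \<alpha> (\<gamma> + 1)) s = 0"
  shows "\<alpha> \<le> 1 \<Longrightarrow> Re (e * cnj s) < 0" and "\<alpha> \<le> 0 \<Longrightarrow> Re e < 0"
proof -
  have g1: "\<gamma> + 1 > -1" using \<gamma> by simp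
  let ?P = "jacobi_poly n \<alpha> (\<gamma> + 1)" and ?Q = "jacobi_poly (n - 1) \<alpha> (\<gamma> + 1)"
  have "deriv_poly_1 n ?Q = deriv_poly_1 (n - 1) ?Q"
    by (intro deriv_poly_1_extend) (simp_all add: degree_jacobi_poly \<alpha> g1)
  then have z: "cpoly (deriv_poly_1 n ?P) s + e * cpoly (deriv_poly_1 n ?Q) s = 0"
    using zero by (simp add: jacobi_Phi_def)
  have P: "degree ?P = n" "coeff ?P n > 0" and Q: "degree ?Q < n"
    using n by (simp_all add: degree_jacobi_poly lead_coeff_jacobi_poly_pos \<alpha> g1)
  show "Re (e * cnj s) < 0" if "\<alpha> \<le> 1"
    by (rule stability_inequality_conj[OF \<alpha> \<gamma> jacobi_kappa_pos[OF \<alpha> g1, of "n - 1"] n P Q _ _ s z that])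
       (use jacobi_poly_orthogonal[OF \<alpha> g1] jacobi_integral_lead[OF \<alpha> g1] in auto)
  show "Re e < 0" if "\<alpha> \<le> 0"
    by (rule stability_inequality[OF \<alpha> \<gamma> jacobi_kappa_pos[OF \<alpha> g1, of "n - 1"] n P Q _ _ s z that])
       (use jacobi_poly_orthogonal[OF \<alpha> g1] jacobi_integral_lead[OF \<alpha> g1] in auto)
qed

text \<open>A zero in the closed right half plane would satisfy the hypothesis of
  \<open>jacobi_Phi_inequalities\<close> with e = 0 and yield 0 < 0. The point s = 0 and the degree
  0 lie outside that lemma and are treated directly.\<close>

lemma jacobi_Phi_stable_shifted:
  assumes "\<alpha> > -1" "\<alpha> \<le> 1" "\<gamma> > -1" "Re s \<ge> 0"
  shows "cpoly (jacobi_Phi n \<alpha> (\<gamma> + 1)) s \<noteq> 0"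
proof (cases "s = 0 \<or> n = 0")
  case True
  then show ?thesis
    using cpoly_jacobi_Phi_0[of \<alpha> "\<gamma> + 1" n] assms by (auto simp: cpoly_jacobi_Phi_degree_0)
next
  case False
  then show ?thesis
    using jacobi_Phi_inequalities(1)[of \<alpha> \<gamma> n s 0] assms by auto
qed

text \<open>The inequalities are applied with e = -X s. At s = i y one has Re (e cnj s) = y Im e, so
  the first one controls the imaginary part of the ratio.\<close>

lemma jacobi_Phi_ratio_shifted:
  assumes "\<alpha> > -1" "\<alpha> \<le> 1" "\<gamma> > -1" "n \<ge> 1"
  defines "X \<equiv> \<lambda>s. cpoly (jacobi_Phi n \<alpha> (\<gamma> + 1)) s / cpoly (jacobi_Phi (n - 1) \<alpha> (\<gamma> + 1)) s"
  shows "y > 0 \<Longrightarrow> Im (X (\<i> * of_real y)) > 0"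
    and "\<lbrakk>\<alpha> \<le> 0; Re s \<ge> 0; s \<noteq> 0\<rbrakk> \<Longrightarrow> Re (X s) > 0"
proof -
  have zero: "cpoly (jacobi_Phi n \<alpha> (\<gamma> + 1)) s + (- X s) * cpoly (jacobi_Phi (n - 1) \<alpha> (\<gamma> + 1)) s = 0"
    if "Re s \<ge> 0" for s
    using jacobi_Phi_stable_shifted[OF assms(1-3) that] by (simp add: X_def)
  show "Im (X (\<i> * of_real y)) > 0" if "y > 0"
    using jacobi_Phi_inequalities(1)[OF assms(1,3,4) _ _ zero, of "\<i> * of_real y"] that assms(2)
    by (simp add: zero_less_mult_iff)
  show "Re (X s) > 0" if "\<alpha> \<le> 0" "Re s \<ge> 0" "s \<noteq> 0"
    using jacobi_Phi_inequalities(2)[OF assms(1,3,4) that(2,3) zero] that by simp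
qed

text \<open>The condition is not symmetric because the estimates are made at the endpoint 1. In
  either range of the theorem both (\<alpha>, \<beta>) and (\<beta>, \<alpha>) satisfy it.\<close>

definition admissible :: "real \<Rightarrow> real \<Rightarrow> bool" where
  "admissible \<alpha> \<beta> \<longleftrightarrow> (-1 < \<alpha> \<and> \<alpha> \<le> 0 \<and> -1 < \<beta>) \<or> (-1 < \<alpha> \<and> \<alpha> \<le> 1 \<and> 0 < \<beta>)"

lemma Im_mult_cnj_pos: "\<lbrakk>z \<noteq> 0; Im (w / z) > 0\<rbrakk> \<Longrightarrow> Im (w * cnj z) > 0"
proof -
  assume z: "z \<noteq> 0" "Im (w / z) > 0"
  have "w * cnj z = of_real ((cmod z)\<^sup>2) * (w / z)"
    unfolding complex_norm_square using z(1) by simp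
  then have "Im (w * cnj z) = (cmod z)\<^sup>2 * Im (w / z)"
    by (simp only: Im_complex_of_real Re_complex_of_real times_complex.sel)
  with z show ?thesis by simp
qed

text \<open>For \<beta> > 0 the shifted results apply with \<gamma> = \<beta> - 1. Otherwise
  \<alpha> \<le> 0, and \<open>jacobi_poly_shift_right\<close> writes Phi as a positive multiple of
  (X + c) times a nonvanishing factor, where X is the ratio for \<beta> + 1 and lies in the right
  half plane.\<close>

lemma jacobi_Phi_admissible:
  assumes adm: "admissible \<alpha> \<beta>"
  shows jacobi_Phi_stable: "Re s \<ge> 0 \<Longrightarrow> cpoly (jacobi_Phi n \<alpha> \<beta>) s \<noteq> 0"
    and jacobi_Phi_Im_pos: "\<lbrakk>n \<ge> 1; y > 0\<rbrakk> \<Longrightarrow>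
      Im (cpoly (jacobi_Phi n \<alpha> \<beta>) (\<i> * of_real y) * cnj (cpoly (jacobi_Phi (n - 1) \<alpha> \<beta>) (\<i> * of_real y))) > 0"
proof -
  have "(cpoly (jacobi_Phi n \<alpha> \<beta>) s \<noteq> 0 \<or> Re s < 0) \<and> (n \<ge> 1 \<longrightarrow> y > 0 \<longrightarrow>
      Im (cpoly (jacobi_Phi n \<alpha> \<beta>) (\<i> * of_real y) * cnj (cpoly (jacobi_Phi (n - 1) \<alpha> \<beta>) (\<i> * of_real y))) > 0)"
    for n s and y
  proof (cases "\<beta> > 0")
    case True
    then have g: "\<alpha> > -1" "\<alpha> \<le> 1" "\<beta> - 1 > -1" using adm by (auto simp: admissible_def)
    show ?thesis
      using jacobi_Phi_stable_shifted[OF g] jacobi_Phi_ratio_shifted(1)[OF g, of n y]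
      by (auto intro!: Im_mult_cnj_pos simp del: times_complex.sel simp: not_less[symmetric])
  next
    case False
    then have a: "\<alpha> > -1" "\<alpha> \<le> 0" and b: "\<beta> > -1" using adm by (auto simp: admissible_def)
    then have a1: "\<alpha> \<le> 1" by simp
    let ?F = "\<lambda>n. cpoly (jacobi_Phi n \<alpha> (\<beta> + 1))"
    have shift: "\<exists>x c. x > 0 \<and> c > 0 \<and> (\<forall>s. cpoly (jacobi_Phi n \<alpha> \<beta>) s
        = of_real x * (?F n s + of_real c * ?F (n - 1) s))" if n: "n \<ge> 1" for n
    proof -
      obtain x c where xc: "x > 0" "c > 0" "jacobi_poly n \<alpha> \<beta>
          = smult x (jacobi_poly n \<alpha> (\<beta> + 1) + smult c (jacobi_poly (n - 1) \<alpha> (\<beta> + 1)))"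
        using jacobi_poly_shift_right[OF a(1) b n] by blast
      have "deriv_poly_1 n (jacobi_poly (n - 1) \<alpha> (\<beta> + 1))
          = deriv_poly_1 (n - 1) (jacobi_poly (n - 1) \<alpha> (\<beta> + 1))"
        using a b by (intro deriv_poly_1_extend) (simp_all add: degree_jacobi_poly)
      then show ?thesis
        using xc by (intro exI[of _ x] exI[of _ c])
          (simp add: jacobi_Phi_def deriv_poly_1_add deriv_poly_1_smult cpoly_simps)
    qed
    let ?X = "\<lambda>n s. ?F n s / ?F (n - 1) s"
    have stable: "?F n s \<noteq> 0" if "Re s \<ge> 0" for n s
      using jacobi_Phi_stable_shifted[OF a(1) a1 b that] .
    have ReX: "Re (?X n s) > 0" if "n \<ge> 1" "Re s \<ge> 0" "s \<noteq> 0" for n s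
      using jacobi_Phi_ratio_shifted(2)[OF a(1) a1 b that(1) a(2) that(2,3)] .
    have ImX: "Im (?X n (\<i> * of_real y)) > 0" if "n \<ge> 1" "y > 0" for n y
      using jacobi_Phi_ratio_shifted(1)[OF a(1) a1 b that] .
    have "cpoly (jacobi_Phi n \<alpha> \<beta>) s \<noteq> 0" if "Re s \<ge> 0"
    proof (cases "s = 0 \<or> n = 0")
      case True
      then show ?thesis
        using cpoly_jacobi_Phi_0[OF a(1) b, of n] by (auto simp: cpoly_jacobi_Phi_degree_0)
    next
      case False
      then have n: "n \<ge> 1" by simp
      obtain x c where xc: "x > 0" "c > 0"
        "\<And>s. cpoly (jacobi_Phi n \<alpha> \<beta>) s = of_real x * (?F n s + of_real c * ?F (n - 1) s)"
        using shift[OF n] by blast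
      have "?F n s = ?X n s * ?F (n - 1) s" using stable[OF that] by simp
      then have "cpoly (jacobi_Phi n \<alpha> \<beta>) s = of_real x * ((?X n s + of_real c) * ?F (n - 1) s)"
        unfolding xc(3) by (simp add: distrib_right)
      moreover have "Re (?X n s + of_real c) > 0"
        using ReX[OF n that] False xc(2) by simp
      then have "?X n s + of_real c \<noteq> 0" by (metis less_irrefl zero_complex.sel(1))
      ultimately show ?thesis using xc(1) stable[OF that, of "n - 1"] by simp
    qed
    moreover have "Im (cpoly (jacobi_Phi n \<alpha> \<beta>) (\<i> * of_real y)
        * cnj (cpoly (jacobi_Phi (n - 1) \<alpha> \<beta>) (\<i> * of_real y))) > 0" if n: "n \<ge> 1" and y: "y > 0"
    proof (cases "n = 1")
      case True
      then show ?thesis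
        using higher_pderiv_jacobi_1_pos[OF a(1) b, of 1 1] y
        by (simp add: cpoly_jacobi_Phi_degree_0)
           (simp add: jacobi_Phi_def deriv_poly_1_def map_poly_monom poly_monom cpoly_simps)
    next
      case False
      with n have n1: "n - 1 \<ge> 1" by simp
      let ?s = "\<i> * complex_of_real y"
      have s: "Re ?s \<ge> 0" "?s \<noteq> 0" using y by auto
      obtain x c where xc: "x > 0" "c > 0"
        "\<And>s. cpoly (jacobi_Phi n \<alpha> \<beta>) s = of_real x * (?F n s + of_real c * ?F (n - 1) s)"
        using shift[OF n] by blast
      obtain x' c' where xc': "x' > 0" "c' > 0" "\<And>s. cpoly (jacobi_Phi (n - 1) \<alpha> \<beta>) s
          = of_real x' * (?F (n - 1) s + of_real c' * ?F (n - 1 - 1) s)"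
        using shift[OF n1] by blast
      \<comment> \<open>All three consecutive values are expressed by Z and two successive ratios,
        so that only the squared modulus of Z factors out of the product.\<close>
      define X Y Z where "X = ?X n ?s" and "Y = ?X (n - 1) ?s" and "Z = ?F (n - 1 - 1) ?s"
      have F1: "?F (n - 1) ?s = Y * Z" using stable[OF s(1)] by (simp add: Y_def Z_def)
      have F0: "?F n ?s = X * (Y * Z)" using stable[OF s(1)] by (simp add: X_def flip: F1)
      have pos: "Re X > 0" "Im X > 0" "Re Y > 0" "Im Y > 0" "Z \<noteq> 0"
        using ReX[OF n s] ReX[OF n1 s] ImX[OF n y] ImX[OF n1 y] stable[OF s(1)]
        by (simp_all only: X_def Y_def Z_def not_False_eq_True)
      have "cpoly (jacobi_Phi n \<alpha> \<beta>) ?s * cnj (cpoly (jacobi_Phi (n - 1) \<alpha> \<beta>) ?s)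
          = of_real (x * x') * ((X + of_real c) * (Y * cnj Y + of_real c' * Y)) * (Z * cnj Z)"
        unfolding xc(3) xc'(3) F1 F0 Z_def[symmetric] by (simp add: algebra_simps)
      also have "\<dots> = of_real (x * x' * (cmod Z)\<^sup>2) * ((X + of_real c) * (of_real ((cmod Y)\<^sup>2) + of_real c' * Y))"
        by (simp only: complex_norm_square of_real_mult mult_ac)
      \<comment> \<open>X and Y lie in the open first quadrant, so every summand is
        positive.\<close>
      also have "Im \<dots> = (x * x' * (cmod Z)\<^sup>2) * (Im X * (cmod Y)\<^sup>2 + c' * (Re X * Im Y + Im X * Re Y) + c * c' * Im Y)"
        by (simp add: algebra_simps)
      also have "\<dots> > 0"
        using pos xc(1,2) xc'(1,2) by (intro mult_pos_pos add_nonneg_pos add_nonneg_nonneg) auto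
      finally show ?thesis .
    qed
    ultimately show ?thesis by force
  qed
  from this[of n s y] show "Re s \<ge> 0 \<Longrightarrow> cpoly (jacobi_Phi n \<alpha> \<beta>) s \<noteq> 0"
    "\<lbrakk>n \<ge> 1; y > 0\<rbrakk> \<Longrightarrow>
      Im (cpoly (jacobi_Phi n \<alpha> \<beta>) (\<i> * of_real y) * cnj (cpoly (jacobi_Phi (n - 1) \<alpha> \<beta>) (\<i> * of_real y))) > 0"
    by auto
qed

section \<open>Hermite--Biehler theory for the even part\<close>

text \<open>The odd part of Phi divided by s, as a polynomial in s^2. For even n the top summand is
  a derivative of order n + 1 and vanishes.\<close>

definition jacobi_Odd :: "nat \<Rightarrow> real \<Rightarrow> real \<Rightarrow> real poly" where
  "jacobi_Odd n \<alpha> \<beta> = (\<Sum>k\<le>n div 2. monom (poly ((pderiv ^^ Suc (2 * k)) (jacobi_poly n \<alpha> \<beta>)) 1) k)"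

lemma cpoly_sum_monom: "cpoly (\<Sum>k\<in>A. monom (f k) (g k)) z = (\<Sum>k\<in>A. of_real (f k) * z ^ g k)"
  by (simp add: map_poly_of_real_sum map_poly_monom poly_monom poly_sum)

lemma sum_even_odd: "(\<Sum>k<2 * m. f k) = (\<Sum>k<m. f (2 * k) + f (Suc (2 * k)))"
  for f :: "nat \<Rightarrow> 'a::comm_monoid_add"
  by (induction m) (simp_all add: add_ac)

lemma cpoly_jacobi_Phi_even_odd:
  assumes "\<alpha> > -1" "\<beta> > -1"
  shows "cpoly (jacobi_Phi n \<alpha> \<beta>) s
    = cpoly (jacobi_Omega n \<alpha> \<beta>) (s\<^sup>2) + s * cpoly (jacobi_Odd n \<alpha> \<beta>) (s\<^sup>2)"
proof -
  define d where "d k = complex_of_real (poly ((pderiv ^^ k) (jacobi_poly n \<alpha> \<beta>)) 1)" for k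
  have d0: "d k = 0" if "k > n" for k
    using that assms by (simp add: d_def higher_pderiv_degree_less degree_jacobi_poly)
  have "cpoly (jacobi_Phi n \<alpha> \<beta>) s = (\<Sum>k\<le>n. d k * s ^ k)"
    by (simp add: jacobi_Phi_def deriv_poly_1_def cpoly_sum_monom d_def)
  \<comment> \<open>Derivatives beyond order n vanish, so the sum may be lengthened to an even
    number of terms and split into pairs.\<close>
  also have "\<dots> = (\<Sum>k<2 * Suc (n div 2). d k * s ^ k)"
    by (intro sum.mono_neutral_left) (auto simp: d0 not_le)
  also have "\<dots> = (\<Sum>k\<le>n div 2. d (2 * k) * s ^ (2 * k)) + s * (\<Sum>k\<le>n div 2. d (Suc (2 * k)) * s ^ (2 * k))"
    unfolding sum_even_odd by (simp add: sum.distrib sum_distrib_left lessThan_Suc_atMost mult_ac)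
  also have "\<dots> = cpoly (jacobi_Omega n \<alpha> \<beta>) (s\<^sup>2) + s * cpoly (jacobi_Odd n \<alpha> \<beta>) (s\<^sup>2)"
    by (simp only: jacobi_Omega_def jacobi_Odd_def cpoly_sum_monom d_def power_mult)
  finally show ?thesis .
qed

text \<open>The two facts below are the Hermite--Biehler theorem: a stable polynomial is larger at \<open>s\<close> than
  at the mirror image of \<open>s\<close> in the imaginary axis, and its argument increases along that axis.\<close>

lemma stable_prod_mirror_less:
  assumes "\<And>x. x \<in># A \<Longrightarrow> Re x < 0" "Re s > 0"
  shows "cmod (\<Prod>x\<in>#A. - cnj s - x) \<le> cmod (\<Prod>x\<in>#A. s - x)
    \<and> (A \<noteq> {#} \<longrightarrow> cmod (\<Prod>x\<in>#A. - cnj s - x) < cmod (\<Prod>x\<in>#A. s - x))"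
  using assms(1)
proof (induction A)
  case (add x A)
  have x: "Re x < 0" using add.prems by simp
  \<comment> \<open>The two points have equal imaginary parts, and the squared distances to x differ
    by -4 Re s Re x > 0.\<close>
  have "(cmod (- cnj s - x))\<^sup>2 < (cmod (s - x))\<^sup>2"
  proof -
    have "Re s * Re x < 0" using x assms(2) by (simp add: mult_pos_neg)
    then show ?thesis unfolding cmod_power2 by (simp add: power2_eq_square algebra_simps)
  qed
  then have lt: "cmod (- cnj s - x) < cmod (s - x)" by (simp add: power_less_imp_less_base)
  have "s \<noteq> y" if "y \<in># A" for y using add.prems[of y] assms(2) that by auto
  then have pos: "cmod (\<Prod>y\<in>#A. s - y) > 0" by (auto simp: prod_mset_zero_iff)
  have "cmod (- cnj s - x) * cmod (\<Prod>y\<in>#A. - cnj s - y) \<le> cmod (- cnj s - x) * cmod (\<Prod>y\<in>#A. s - y)"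
    using add by (intro mult_left_mono) auto
  also have "\<dots> < cmod (s - x) * cmod (\<Prod>y\<in>#A. s - y)"
    using lt pos by simp
  finally show ?case by (simp add: norm_mult)
qed simp

lemma stable_prod_log_deriv:
  assumes "\<And>x. x \<in># A \<Longrightarrow> Re x < 0" "Re s \<ge> 0" "A \<noteq> {#}"
  shows "Re (poly (pderiv (\<Prod>x\<in>#A. [:- x, 1:])) s * cnj (poly (\<Prod>x\<in>#A. [:- x, 1:]) s)) > 0"
  using assms(1,3)
proof (induction A)
  case (add x A)
  let ?G = "\<Prod>x\<in>#A. [:- x, 1:]"
  have x: "Re x < 0" using add.prems by simp
  \<comment> \<open>G' cnj G is the squared modulus of G times the logarithmic derivative of G; each
    root x adds the term 1 / (s - x), of positive real part.\<close>
  have "poly (pderiv (\<Prod>x\<in>#add_mset x A. [:- x, 1:])) s * cnj (poly (\<Prod>x\<in>#add_mset x A. [:- x, 1:]) s)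
    = (poly ?G s * cnj (poly ?G s)) * cnj (s - x) + ((s - x) * cnj (s - x)) * (poly (pderiv ?G) s * cnj (poly ?G s))"
    unfolding image_mset_add_mset prod_mset.add_mset pderiv_mult
    by (simp add: pderiv_pCons algebra_simps)
  also have "\<dots> = of_real ((cmod (poly ?G s))\<^sup>2) * cnj (s - x)
      + of_real ((cmod (s - x))\<^sup>2) * (poly (pderiv ?G) s * cnj (poly ?G s))"
    by (simp only: complex_norm_square)
  finally have "Re (poly (pderiv (\<Prod>x\<in>#add_mset x A. [:- x, 1:])) s * cnj (poly (\<Prod>x\<in>#add_mset x A. [:- x, 1:]) s))
     = (cmod (poly ?G s))\<^sup>2 * (Re s - Re x)
      + (cmod (s - x))\<^sup>2 * Re (poly (pderiv ?G) s * cnj (poly ?G s))"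
    by (simp only: plus_complex.sel times_complex.sel Re_complex_of_real Im_complex_of_real) simp
  moreover have "poly ?G s \<noteq> 0"
  proof -
    have "s \<noteq> y" if "y \<in># A" for y using add.prems(1)[of y] assms(2) that by auto
    then show ?thesis by (auto simp: poly_prod_mset prod_mset_zero_iff)
  qed
  moreover have "Re (poly (pderiv ?G) s * cnj (poly ?G s)) \<ge> 0"
  proof (cases "A = {#}")
    case False
    then show ?thesis using add by (intro less_imp_le) auto
  qed simp
  ultimately show ?case using x assms(2) by (simp add: add_pos_nonneg)
qed simp

text \<open>F has real coefficients, so F has the same modulus at -s and at -cnj s, the mirror image
  of s. Factoring F over its roots reduces both claims to the two preceding products.\<close>

lemma
  fixes F :: "real poly"
  assumes stable: "\<And>s. Re s \<ge> 0 \<Longrightarrow> cpoly F s \<noteq> 0"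
  shows stable_mirror_sum_nonzero: "Re s > 0 \<Longrightarrow> cpoly F s + cpoly F (- s) \<noteq> 0"
    and stable_log_deriv: "\<lbrakk>Re s \<ge> 0; cpoly F s + cpoly F (- s) = 0\<rbrakk> \<Longrightarrow>
      Re (cpoly (pderiv F) s * cnj (cpoly F s)) > 0"
proof -
  let ?F = "map_poly complex_of_real F"
  have F0: "?F \<noteq> 0" using stable[of 0] by auto
  define A c where "A = proots ?F" and "c = lead_coeff ?F"
  have c: "c \<noteq> 0" using F0 by (simp add: c_def)
  have A: "Re x < 0" if "x \<in># A" for x
    using that F0 stable[of x] by (auto simp: A_def set_count_proots not_le[symmetric])
  have F: "?F = smult c (\<Prod>x\<in>#A. [:- x, 1:])"
    unfolding c_def A_def by (rule complex_poly_decompose_multiset[symmetric])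
  have val: "cpoly F z = c * (\<Prod>x\<in>#A. z - x)" for z
    unfolding F by (simp add: poly_prod_mset image_mset.compositionality o_def)
  have mirror: "cmod (cpoly F (- s)) = cmod (cpoly F (- cnj s))" for s
  proof -
    have "cpoly F (- cnj s) = cnj (cpoly F (- s))"
      by (subst poly_cnj) (simp add: map_poly_map_poly o_def)
    then show ?thesis by simp
  qed
  show "cpoly F s + cpoly F (- s) \<noteq> 0" if "Re s > 0"
  proof (cases "A = {#}")
    case False
    with stable_prod_mirror_less[OF A that] have "cmod (cpoly F (- cnj s)) < cmod (cpoly F s)"
      using c by (simp add: val norm_mult)
    then have "cmod (cpoly F (- s)) < cmod (cpoly F s)" by (subst mirror)
    then show ?thesis by (metis add_eq_0_iff less_irrefl norm_minus_cancel)
  qed (simp add: val c)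
  show "Re (cpoly (pderiv F) s * cnj (cpoly F s)) > 0" if s: "Re s \<ge> 0" "cpoly F s + cpoly F (- s) = 0"
  proof -
    \<comment> \<open>A constant F = c would give F(s) + F(-s) = 2 c, which is not zero; so F has a
      root.\<close>
    have "A \<noteq> {#}" using s(2) c by (auto simp: val)
    from stable_prod_log_deriv[OF A s(1) this] have "Re (poly (pderiv (\<Prod>x\<in>#A. [:- x, 1:])) s
        * cnj (poly (\<Prod>x\<in>#A. [:- x, 1:]) s)) * (cmod c)\<^sup>2 > 0"
      using c by simp
    moreover have "cpoly (pderiv F) s * cnj (cpoly F s) = of_real ((cmod c)\<^sup>2) *
      (poly (pderiv (\<Prod>x\<in>#A. [:- x, 1:])) s * cnj (poly (\<Prod>x\<in>#A. [:- x, 1:]) s))"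
      unfolding map_poly_of_real_pderiv F complex_norm_square by (simp add: pderiv_smult)
    ultimately show ?thesis by (simp add: mult.commute)
  qed
qed

context
  fixes \<alpha> \<beta> :: real
  assumes adm: "admissible \<alpha> \<beta>"
begin

lemma admissible_gt: "\<alpha> > -1" "\<beta> > -1"
  using adm by (auto simp: admissible_def)

lemma jacobi_Phi_mirror_sum:
  "cpoly (jacobi_Phi n \<alpha> \<beta>) s + cpoly (jacobi_Phi n \<alpha> \<beta>) (- s) = 2 * cpoly (jacobi_Omega n \<alpha> \<beta>) (s\<^sup>2)"
  by (simp add: cpoly_jacobi_Phi_even_odd[OF admissible_gt])

lemma jacobi_Omega_0_pos: "poly (jacobi_Omega n \<alpha> \<beta>) 0 > 0"
proof -
  have "poly (jacobi_Omega n \<alpha> \<beta>) 0 = poly (jacobi_poly n \<alpha> \<beta>) 1"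
    by (simp add: jacobi_Omega_def poly_0_coeff_0 coeff_sum)
  with higher_pderiv_jacobi_1_pos[OF admissible_gt, of 0 n] show ?thesis by simp
qed

text \<open>With s the principal square root of z, 2 Omega(z) = Phi(s) + Phi(-s) cannot vanish for
  Re s > 0. So s is imaginary, and it is not 0 because Omega is positive at 0.\<close>

lemma jacobi_Omega_root:
  assumes "cpoly (jacobi_Omega n \<alpha> \<beta>) z = 0"
  obtains y where "y > 0" "z = of_real (- (y\<^sup>2))"
proof -
  define s where "s = csqrt z"
  have s: "s\<^sup>2 = z" "Re s \<ge> 0" using csqrt_principal[of z] by (auto simp: s_def)
  have "Re s = 0"
  proof (rule ccontr)
    assume "Re s \<noteq> 0"
    with s have "Re s > 0" by simp
    from stable_mirror_sum_nonzero[OF jacobi_Phi_stable[OF adm] this] assms s(1) show False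
      by (simp add: jacobi_Phi_mirror_sum)
  qed
  then have "s = \<i> * of_real (Im s)" by (simp add: complex_eq_iff)
  then have z: "z = of_real (- (\<bar>Im s\<bar>\<^sup>2))"
    using s(1) by (metis of_real_minus of_real_power power2_abs power_mult_distrib power2_i mult_minus1)
  have "Im s \<noteq> 0"
    using z assms jacobi_Omega_0_pos[of n] cpoly_of_real[of "jacobi_Omega n \<alpha> \<beta>" 0] by auto
  with z show ?thesis by (intro that[of "\<bar>Im s\<bar>"]) auto
qed

text \<open>At a zero of the even part, Phi(i y) = i y O with O the real value of the odd part. The
  real part of Phi' cnj Phi is then 2 y^2 Omega' O, and \<open>stable_log_deriv\<close> makes it
  positive.\<close>

lemma jacobi_Omega_root_sign:
  assumes y: "y > 0" and root: "poly (jacobi_Omega n \<alpha> \<beta>) (- (y\<^sup>2)) = 0"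
  shows "poly (pderiv (jacobi_Omega n \<alpha> \<beta>)) (- (y\<^sup>2)) * poly (jacobi_Odd n \<alpha> \<beta>) (- (y\<^sup>2)) > 0"
proof -
  let ?E = "jacobi_Omega n \<alpha> \<beta>" and ?O = "jacobi_Odd n \<alpha> \<beta>" and ?F = "jacobi_Phi n \<alpha> \<beta>"
  let ?s = "\<i> * complex_of_real y" and ?x = "- (y\<^sup>2)"
  have sq: "?s\<^sup>2 = of_real ?x" by (simp add: power_mult_distrib)
  have F: "map_poly complex_of_real ?F = pcompose (map_poly complex_of_real ?E) [:0, 0, 1:]
      + [:0, 1:] * pcompose (map_poly complex_of_real ?O) [:0, 0, 1:]"
    by (rule poly_ext) (simp add: cpoly_jacobi_Phi_even_odd[OF admissible_gt] poly_pcompose power2_eq_square)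
  have Fs: "cpoly ?F ?s = ?s * of_real (poly ?O ?x)"
    unfolding cpoly_jacobi_Phi_even_odd[OF admissible_gt] sq cpoly_of_real root by simp
  have F's: "cpoly (pderiv ?F) ?s = 2 * ?s * of_real (poly (pderiv ?E) ?x)
      + of_real (poly ?O ?x - 2 * y\<^sup>2 * poly (pderiv ?O) ?x)"
  proof -
    have sq': "?s * ?s = of_real ?x" using sq by (simp add: power2_eq_square)
    have "cpoly (pderiv ?F) ?s = 2 * ?s * cpoly (pderiv ?E) (?s * ?s)
        + cpoly ?O (?s * ?s) + 2 * (?s * ?s) * cpoly (pderiv ?O) (?s * ?s)"
      unfolding map_poly_of_real_pderiv F pderiv_add pderiv_mult pderiv_pcompose
      by (simp add: pderiv_pCons poly_pcompose algebra_simps)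
    then show ?thesis unfolding sq' cpoly_of_real by simp
  qed
  have "cpoly ?F ?s + cpoly ?F (- ?s) = 0"
    unfolding jacobi_Phi_mirror_sum sq cpoly_of_real root by simp
  then have "Re (cpoly (pderiv ?F) ?s * cnj (cpoly ?F ?s)) > 0"
    by (intro stable_log_deriv[OF jacobi_Phi_stable[OF adm]]) auto
  also have "Re (cpoly (pderiv ?F) ?s * cnj (cpoly ?F ?s)) = 2 * y\<^sup>2 * (poly (pderiv ?E) ?x * poly ?O ?x)"
    unfolding Fs F's by (simp add: power2_eq_square)
  finally show ?thesis using y by (simp add: zero_less_mult_iff)
qed

text \<open>At s = i y with x = -y^2 a zero of the lower even part, Im (Phi_n cnj Phi_(n-1)) equals
  -y Omega_n O_(n-1), which is positive. By \<open>jacobi_Omega_root_sign\<close>, O_(n-1) has the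
  sign of the derivative of Omega_(n-1).\<close>

lemma jacobi_Omega_interlace:
  assumes n: "n \<ge> 1" and root: "poly (jacobi_Omega (n - 1) \<alpha> \<beta>) x = 0"
  shows "poly (jacobi_Omega n \<alpha> \<beta>) x * poly (pderiv (jacobi_Omega (n - 1) \<alpha> \<beta>)) x < 0"
proof -
  let ?E = "\<lambda>n. poly (jacobi_Omega n \<alpha> \<beta>) x" and ?O = "\<lambda>n. poly (jacobi_Odd n \<alpha> \<beta>) x"
  have "cpoly (jacobi_Omega (n - 1) \<alpha> \<beta>) (of_real x) = 0"
    unfolding cpoly_of_real root by simp
  then obtain y where y: "y > 0" "complex_of_real x = of_real (- (y\<^sup>2))"
    by (rule jacobi_Omega_root)
  then have x: "x = - (y\<^sup>2)" by (simp only: of_real_eq_iff)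
  let ?s = "\<i> * complex_of_real y"
  have sq: "?s\<^sup>2 = of_real x" by (simp add: power_mult_distrib x)
  have F: "cpoly (jacobi_Phi m \<alpha> \<beta>) ?s = of_real (?E m) + ?s * of_real (?O m)" for m
    unfolding cpoly_jacobi_Phi_even_odd[OF admissible_gt] sq cpoly_of_real ..
  have "y * (?E n * ?O (n - 1)) < 0"
    using jacobi_Phi_Im_pos[OF adm n y(1)] unfolding F root by (simp add: mult_ac)
  then have "?E n * ?O (n - 1) < 0" using y(1) by (simp add: mult_less_0_iff)
  moreover have "poly (pderiv (jacobi_Omega (n - 1) \<alpha> \<beta>)) x * ?O (n - 1) > 0"
    using jacobi_Omega_root_sign[OF y(1), of "n - 1"] root unfolding x by simp
  ultimately show ?thesis by (auto simp: mult_less_0_iff zero_less_mult_iff)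
qed

lemma jacobi_Omega_coeff_pos: "k \<le> n div 2 \<Longrightarrow> coeff (jacobi_Omega n \<alpha> \<beta>) k > 0"
  unfolding jacobi_Omega_def coeff_sum by (simp add: sum.delta' higher_pderiv_jacobi_1_pos[OF admissible_gt])

lemma degree_jacobi_Omega: "degree (jacobi_Omega n \<alpha> \<beta>) = n div 2"
proof (rule antisym)
  show "degree (jacobi_Omega n \<alpha> \<beta>) \<le> n div 2"
    unfolding jacobi_Omega_def by (intro degree_sum_le) (auto intro: order.trans[OF degree_monom_le])
  show "n div 2 \<le> degree (jacobi_Omega n \<alpha> \<beta>)"
    using jacobi_Omega_coeff_pos[of "n div 2" n] by (intro le_degree) auto
qed

end

section \<open>Interlacing and the characteristic polynomial\<close>

lemma card_roots_rsquarefree: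
  assumes "rsquarefree (p :: complex poly)"
  shows "card {z. poly p z = 0} = degree p"
proof -
  have p0: "p \<noteq> 0" using assms by (simp add: rsquarefree_def)
  have "degree p = degree (smult (lead_coeff p) (\<Prod>z | poly p z = 0. [:- z, 1:]))"
    using complex_poly_decompose_rsquarefree[OF assms] by simp
  also have "\<dots> = (\<Sum>z | poly p z = 0. 1)"
    using p0 by (simp add: degree_prod_eq_sum_degree)
  finally show ?thesis by simp
qed

text \<open>This is p / q = r + k X - sum of \<rho> x / (X - x) over the roots x of q, with the
  denominators cleared; each -\<rho> x is the residue p / q' at x.\<close>

lemma partial_fraction_expansion:
  fixes p q :: "real poly"
  assumes real: "\<And>z. cpoly q z = 0 \<Longrightarrow> Im z = 0"
    and sign: "\<And>x. poly q x = 0 \<Longrightarrow> poly p x * poly (pderiv q) x < 0"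
    and deg: "degree p \<le> Suc (degree q)" and q0: "q \<noteq> 0"
    and lead: "coeff p (Suc (degree q)) * lead_coeff q \<ge> 0"
  obtains k r :: real and \<rho> :: "real \<Rightarrow> real" where "k * lead_coeff q = coeff p (Suc (degree q))" "k \<ge> 0"
    "\<And>x. poly q x = 0 \<Longrightarrow> \<rho> x > 0" "card {x. poly q x = 0} = degree q"
    "p = [:r, k:] * q - (\<Sum>x | poly q x = 0. smult (\<rho> x) (q div [:- x, 1:]))"
proof -
  define d where "d = degree q"
  define X where "X = {x. poly q x = 0}"
  have fin: "finite X" unfolding X_def by (rule poly_roots_finite[OF q0])
  have lc: "coeff q d \<noteq> 0" using q0 by (simp add: d_def)
  let ?Q = "map_poly complex_of_real q"
  have roots: "{z. poly ?Q z = 0} = of_real ` X"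
  proof (intro equalityI subsetI)
    fix z assume "z \<in> {z. poly ?Q z = 0}"
    then have z: "poly ?Q z = 0" by simp
    then have "z = of_real (Re z)" using real[OF z] by (simp add: complex_eq_iff)
    moreover from this have "poly q (Re z) = 0" using z cpoly_of_real[of q "Re z"] by simp
    ultimately show "z \<in> of_real ` X" by (auto simp: X_def)
  qed (auto simp: X_def cpoly_of_real)
  \<comment> \<open>At a common zero of q and q' the product in \<open>sign\<close> would be 0. So
    all roots are simple, and there are as many as the degree.\<close>
  have "rsquarefree ?Q"
    unfolding rsquarefree_roots
  proof (intro allI notI)
    fix z assume z: "poly ?Q z = 0 \<and> poly (pderiv ?Q) z = 0"
    then obtain x where x: "z = of_real x" "poly q x = 0" using roots by (auto simp: X_def)
    have "poly (pderiv q) x = 0"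
      using z unfolding map_poly_of_real_pderiv[symmetric] x(1) cpoly_of_real by simp
    with sign[OF x(2)] show False by simp
  qed
  then have "card {z. poly ?Q z = 0} = degree ?Q" by (rule card_roots_rsquarefree)
  then have card: "card X = d"
    unfolding roots by (simp add: card_image inj_on_def d_def degree_map_poly)
  \<comment> \<open>k and r are chosen so that s below loses its coefficients in degrees d + 1 and
    d.\<close>
  define k where "k = coeff p (Suc d) / coeff q d"
  define r where "r = (coeff p d - coeff ([:0, k:] * q) d) / coeff q d"
  define s where "s = p - [:r, k:] * q"
  define \<rho> where "\<rho> x = - (poly p x / poly (pderiv q) x)" for x
  define t where "t x = q div [:- x, 1:]" for x
  have t: "q = [:- x, 1:] * t x" if "x \<in> X" for x
    using that dvd_mult_div_cancel[of "[:- x, 1:]" q]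
    by (simp add: t_def X_def poly_eq_0_iff_dvd del: mult_pCons_left)
  have k: "k \<ge> 0"
    using lead lc unfolding k_def d_def[symmetric]
    by (metis divide_nonneg_nonneg divide_nonpos_nonpos linorder_linear mult_le_0_iff mult_nonneg_nonneg
        order_antisym_conv divide_eq_0_iff mult_eq_0_iff zero_le_mult_iff)
  have \<rho>: "\<rho> x > 0" if "x \<in> X" for x
    using sign[of x] that by (auto simp: \<rho>_def X_def mult_less_0_iff divide_less_0_iff)
  have ds: "degree s \<le> Suc d"
    unfolding s_def using deg
    by (intro degree_diff_le order.trans[OF degree_mult_le]) (auto simp: d_def)
  have c1: "coeff s (Suc d) = 0"
    using lc by (simp add: s_def k_def coeff_eq_0 d_def)
  then have ds': "degree s \<le> d" using degree_less_or_0[OF ds] by auto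
  have c2: "coeff s d = 0"
    using lc by (cases d) (simp_all add: s_def r_def)
  then have ds'': "s = 0 \<or> degree s < d" by (intro degree_less_or_0 ds')
  have dt: "degree (t x) < d" if "x \<in> X" for x
  proof -
    have "t x \<noteq> 0" using t[OF that] q0 by auto
    then have "degree q = Suc (degree (t x))"
      by (subst t[OF that], subst degree_mult_eq) auto
    then show ?thesis by (simp add: d_def)
  qed
  have tval: "poly (t x) y = (if x = y then poly (pderiv q) y else 0)" if "x \<in> X" "y \<in> X" for x y
  proof (cases "x = y")
    case True
    have "poly (pderiv q) x = poly (t x) x"
      by (subst t[OF that(1)], subst pderiv_mult) (simp add: pderiv_pCons)
    then show ?thesis using True by simp
  next
    case False
    have "poly q y = (y - x) * poly (t x) y"
      by (subst t[OF that(1)]) (simp add: algebra_simps)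
    then have "(y - x) * poly (t x) y = 0" using that(2) by (simp add: X_def)
    with False show ?thesis by simp
  qed
  have "s = - (\<Sum>x\<in>X. smult (\<rho> x) (t x))"
  proof (cases "d = 0")
    case True
    then have "X = {}" "s = 0" using card fin ds'' by auto
    then show ?thesis by simp
  next
    case False
    show ?thesis
    \<comment> \<open>Lagrange interpolation: both sides have degree below d and agree at the d
      roots of q.\<close>
    proof (rule poly_eqI_degree[of X])
      fix y assume y: "y \<in> X"
      have "poly (- (\<Sum>x\<in>X. smult (\<rho> x) (t x))) y = - (\<Sum>x\<in>X. if x = y then \<rho> x * poly (pderiv q) y else 0)"
        using y by (simp add: poly_sum tval if_distrib cong: sum.cong if_cong)
      also have "\<dots> = poly p y"
        using y fin sign[of y] by (auto simp: sum.delta \<rho>_def X_def)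
      also have "\<dots> = poly s y" using y by (simp add: s_def X_def)
      finally show "poly s y = poly (- (\<Sum>x\<in>X. smult (\<rho> x) (t x))) y" ..
    next
      show "degree s < card X" using ds'' False card by auto
      have "degree (smult (\<rho> x) (t x)) \<le> d - 1" if "x \<in> X" for x
        using degree_smult_le[of "\<rho> x" "t x"] dt[OF that] by linarith
      then have "degree (\<Sum>x\<in>X. smult (\<rho> x) (t x)) \<le> d - 1"
        by (intro degree_sum_le fin) auto
      then show "degree (- (\<Sum>x\<in>X. smult (\<rho> x) (t x))) < card X" using False card by simp
    qed
  qed
  then have "p = [:r, k:] * q - (\<Sum>x\<in>X. smult (\<rho> x) (t x))"
    by (simp add: s_def algebra_simps)
  then show ?thesis
    using k \<rho> card lc by (intro that[of k \<rho> r]) (auto simp: X_def t_def d_def k_def)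
qed

text \<open>In the partial fraction expansion every non-constant term maps the upper half plane to
  itself and has positive derivative on the real line; \<open>nonconst\<close> guarantees such a
  term. Multiplying by the squared modulus of q, respectively by q^2, keeps both claims free of
  division.\<close>

lemma
  fixes p q :: "real poly"
  assumes real: "\<And>z. cpoly q z = 0 \<Longrightarrow> Im z = 0"
    and sign: "\<And>x. poly q x = 0 \<Longrightarrow> poly p x * poly (pderiv q) x < 0"
    and deg: "degree p \<le> Suc (degree q)" and q0: "q \<noteq> 0"
    and lead: "coeff p (Suc (degree q)) * lead_coeff q \<ge> 0"
    and nonconst: "degree q > 0 \<or> coeff p (Suc (degree q)) \<noteq> 0"
  shows interlacing_Im_pos: "Im z > 0 \<Longrightarrow> Im (cpoly p z * cnj (cpoly q z)) > 0"
    and interlacing_wronskian_pos: "poly (pderiv p) x * poly q x - poly p x * poly (pderiv q) x > 0"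
proof -
  obtain k r \<rho> where kc: "k * lead_coeff q = coeff p (Suc (degree q))" and k: "k \<ge> 0"
    and \<rho>: "\<And>x. poly q x = 0 \<Longrightarrow> \<rho> x > 0" and card: "card {x. poly q x = 0} = degree q"
    and p: "p = [:r, k:] * q - (\<Sum>x | poly q x = 0. smult (\<rho> x) (q div [:- x, 1:]))"
    using partial_fraction_expansion[OF real sign deg q0 lead] by blast
  define X where "X = {x. poly q x = 0}"
  define t where "t x = q div [:- x, 1:]" for x
  have fin: "finite X" unfolding X_def by (rule poly_roots_finite[OF q0])
  have p': "p = [:r, k:] * q - (\<Sum>x\<in>X. smult (\<rho> x) (t x))"
    using p by (simp add: X_def t_def)
  have t: "q = [:- x, 1:] * t x" if "x \<in> X" for x
    using that dvd_mult_div_cancel[of "[:- x, 1:]" q]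
    by (simp add: t_def X_def poly_eq_0_iff_dvd del: mult_pCons_left)
  have nontriv: "k > 0 \<or> X \<noteq> {}"
  proof (cases "degree q > 0")
    case True
    then show ?thesis using card unfolding X_def[symmetric] by auto
  next
    case False
    then have "k \<noteq> 0" using nonconst kc by auto
    with k show ?thesis by simp
  qed
  show "Im (cpoly p z * cnj (cpoly q z)) > 0" if z: "Im z > 0"
  proof -
    have qz: "cpoly q z \<noteq> 0" using real[of z] z by auto
    have tq: "cpoly q z = (z - of_real x) * cpoly (t x) z" if "x \<in> X" for x
      by (subst t[OF that], subst map_poly_of_real_mult) (simp add: map_poly_pCons algebra_simps)
    have Imt: "Im (cpoly (t x) z * cnj (cpoly q z)) = - (Im z * (cmod (cpoly (t x) z))\<^sup>2)" if "x \<in> X" for x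
    proof -
      have "cpoly (t x) z * cnj (cpoly q z) = (cpoly (t x) z * cnj (cpoly (t x) z)) * cnj (z - of_real x)"
        unfolding tq[OF that] by (simp add: mult_ac)
      also have "\<dots> = of_real ((cmod (cpoly (t x) z))\<^sup>2) * cnj (z - of_real x)"
        by (simp only: complex_norm_square)
      finally show ?thesis
        by (simp only: times_complex.sel Re_complex_of_real Im_complex_of_real) simp
    qed
    have "cpoly p z = (of_real r + of_real k * z) * cpoly q z - (\<Sum>x\<in>X. of_real (\<rho> x) * cpoly (t x) z)"
      unfolding p' by (simp add: cpoly_simps poly_sum map_poly_pCons algebra_simps)
    then have "cpoly p z * cnj (cpoly q z) = (of_real r + of_real k * z) * (cpoly q z * cnj (cpoly q z))
        - (\<Sum>x\<in>X. of_real (\<rho> x) * (cpoly (t x) z * cnj (cpoly q z)))"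
      by (simp add: left_diff_distrib sum_distrib_right mult.assoc)
    also have "Im \<dots> = k * Im z * (cmod (cpoly q z))\<^sup>2 - (\<Sum>x\<in>X. \<rho> x * Im (cpoly (t x) z * cnj (cpoly q z)))"
      unfolding complex_norm_square[symmetric] minus_complex.sel Im_sum
      by (simp flip: of_real_power del: times_complex.sel(2) add: times_complex.sel(2)[of "_ + _"] times_complex.sel(2)[of "of_real _"])
    also have "\<dots> = Im z * (k * (cmod (cpoly q z))\<^sup>2 + (\<Sum>x\<in>X. \<rho> x * (cmod (cpoly (t x) z))\<^sup>2))"
    proof -
      have "(\<Sum>x\<in>X. \<rho> x * Im (cpoly (t x) z * cnj (cpoly q z)))
          = (\<Sum>x\<in>X. - (Im z * (\<rho> x * (cmod (cpoly (t x) z))\<^sup>2)))"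
      proof (intro sum.cong refl)
        fix x assume x: "x \<in> X"
        show "\<rho> x * Im (cpoly (t x) z * cnj (cpoly q z)) = - (Im z * (\<rho> x * (cmod (cpoly (t x) z))\<^sup>2))"
          unfolding Imt[OF x] by simp
      qed
      then show ?thesis by (simp only: sum_negf sum_distrib_left[symmetric]) (simp add: algebra_simps)
    qed
    finally have eq: "Im (cpoly p z * cnj (cpoly q z)) = \<dots>" .
    have "\<rho> x * (cmod (cpoly (t x) z))\<^sup>2 > 0" if "x \<in> X" for x
      using \<rho>[of x] tq[OF that] qz that by (auto simp: X_def)
    then have "(\<Sum>x\<in>X. \<rho> x * (cmod (cpoly (t x) z))\<^sup>2) > 0" if "X \<noteq> {}"
      using fin that by (intro sum_pos) auto
    with nontriv k qz fin have "k * (cmod (cpoly q z))\<^sup>2 + (\<Sum>x\<in>X. \<rho> x * (cmod (cpoly (t x) z))\<^sup>2) > 0"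
      by (cases "X = {}") (auto intro!: add_nonneg_pos)
    with z eq show ?thesis by simp
  qed
  show "poly (pderiv p) x * poly q x - poly p x * poly (pderiv q) x > 0"
  proof (cases "poly q x = 0")
    case True
    then show ?thesis using sign[OF True] by simp
  next
    case False
    have tq: "poly q x = (x - y) * poly (t y) x"
      and tq': "poly (pderiv q) x = poly (t y) x + (x - y) * poly (pderiv (t y)) x" if "y \<in> X" for y
    proof -
      show "poly q x = (x - y) * poly (t y) x"
        by (subst t[OF that]) (simp add: algebra_simps)
      show "poly (pderiv q) x = poly (t y) x + (x - y) * poly (pderiv (t y)) x"
        by (subst t[OF that], subst pderiv_mult) (simp add: pderiv_pCons algebra_simps)
    qed
    have e1: "poly p x = (r + k * x) * poly q x - (\<Sum>y\<in>X. \<rho> y * poly (t y) x)"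
      unfolding p' by (simp add: poly_sum algebra_simps)
    have e2: "poly (pderiv p) x = k * poly q x + (r + k * x) * poly (pderiv q) x
        - (\<Sum>y\<in>X. \<rho> y * poly (pderiv (t y)) x)"
      unfolding p' pderiv_diff pderiv_sum pderiv_mult
      by (simp add: poly_sum pderiv_smult pderiv_pCons algebra_simps)
    have e3: "(\<Sum>y\<in>X. \<rho> y * (poly (pderiv (t y)) x * poly q x - poly (t y) x * poly (pderiv q) x))
        = (\<Sum>y\<in>X. \<rho> y * poly (pderiv (t y)) x) * poly q x - (\<Sum>y\<in>X. \<rho> y * poly (t y) x) * poly (pderiv q) x"
      by (simp add: right_diff_distrib sum_subtractf sum_distrib_right mult.assoc)
    have "poly (pderiv p) x * poly q x - poly p x * poly (pderiv q) x
        = k * (poly q x)\<^sup>2 - (\<Sum>y\<in>X. \<rho> y * (poly (pderiv (t y)) x * poly q x - poly (t y) x * poly (pderiv q) x))"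
      unfolding e1 e2 e3 by (simp add: algebra_simps power2_eq_square)
    also have "(\<Sum>y\<in>X. \<rho> y * (poly (pderiv (t y)) x * poly q x - poly (t y) x * poly (pderiv q) x))
        = (\<Sum>y\<in>X. - (\<rho> y * (poly (t y) x)\<^sup>2))"
    proof (intro sum.cong refl)
      fix y assume y: "y \<in> X"
      show "\<rho> y * (poly (pderiv (t y)) x * poly q x - poly (t y) x * poly (pderiv q) x)
        = - (\<rho> y * (poly (t y) x)\<^sup>2)"
        unfolding tq'[OF y] tq[OF y] by (simp add: algebra_simps power2_eq_square)
    qed
    finally have eq: "poly (pderiv p) x * poly q x - poly p x * poly (pderiv q) x
        = k * (poly q x)\<^sup>2 + (\<Sum>y\<in>X. \<rho> y * (poly (t y) x)\<^sup>2)"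
      by (simp add: sum_negf)
    have "\<rho> y * (poly (t y) x)\<^sup>2 > 0" if "y \<in> X" for y
      using \<rho>[of y] tq[OF that] False that by (auto simp: X_def)
    then have "(\<Sum>y\<in>X. \<rho> y * (poly (t y) x)\<^sup>2) > 0" if "X \<noteq> {}"
      using fin that by (intro sum_pos) auto
    with nontriv k False have "k * (poly q x)\<^sup>2 + (\<Sum>y\<in>X. \<rho> y * (poly (t y) x)\<^sup>2) > 0"
      by (cases "X = {}") (auto intro!: add_nonneg_pos)
    with eq show ?thesis by simp
  qed
qed

section \<open>Even parts of consecutive degrees and zeros of the characteristic polynomial\<close>

context
  fixes \<alpha> \<beta> :: real and n :: nat
  assumes adm: "admissible \<alpha> \<beta>" and n: "n \<ge> 2"
begin

lemma jacobi_Omega_interlacing: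
  shows jacobi_Omega_Im_pos: "Im z > 0 \<Longrightarrow>
      Im (cpoly (jacobi_Omega n \<alpha> \<beta>) z * cnj (cpoly (jacobi_Omega (n - 1) \<alpha> \<beta>) z)) > 0"
    and jacobi_Omega_wronskian_pos:
      "poly (pderiv (jacobi_Omega n \<alpha> \<beta>)) x * poly (jacobi_Omega (n - 1) \<alpha> \<beta>) x
        - poly (jacobi_Omega n \<alpha> \<beta>) x * poly (pderiv (jacobi_Omega (n - 1) \<alpha> \<beta>)) x > 0"
proof -
  let ?p = "jacobi_Omega n \<alpha> \<beta>" and ?q = "jacobi_Omega (n - 1) \<alpha> \<beta>"
  have real: "Im z = 0" if "cpoly ?q z = 0" for z
    using jacobi_Omega_root[OF adm that] by force
  have sign: "poly ?p x * poly (pderiv ?q) x < 0" if "poly ?q x = 0" for x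
    using jacobi_Omega_interlace[OF adm _ that] n by simp
  have deg: "degree ?p \<le> Suc (degree ?q)"
    using n by (simp add: degree_jacobi_Omega[OF adm])
  have q0: "?q \<noteq> 0" using jacobi_Omega_0_pos[OF adm, of "n - 1"] by auto
  have lq: "lead_coeff ?q > 0"
    using jacobi_Omega_coeff_pos[OF adm, of "(n - 1) div 2" "n - 1"] by (simp add: degree_jacobi_Omega[OF adm])
  \<comment> \<open>For even n the degree of ?p exceeds that of ?q by one and the expansion has a
    positive linear term. For odd n the degrees agree, and n \<ge> 3 makes them positive.\<close>
  have lp: "coeff ?p (Suc (degree ?q)) \<ge> 0 \<and> (degree ?q > 0 \<or> coeff ?p (Suc (degree ?q)) \<noteq> 0)"
  proof (cases "even n")
    case True
    then have "Suc (degree ?q) = n div 2"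
      using n by (auto simp: degree_jacobi_Omega[OF adm] elim!: evenE)
    then show ?thesis using jacobi_Omega_coeff_pos[OF adm, of "n div 2" n] by simp
  next
    case False
    then have "degree ?q = n div 2" "n div 2 > 0"
      using n by (auto simp: degree_jacobi_Omega[OF adm] elim!: oddE)
    then show ?thesis by (simp add: coeff_eq_0 degree_jacobi_Omega[OF adm])
  qed
  have lead: "coeff ?p (Suc (degree ?q)) * lead_coeff ?q \<ge> 0"
    using lp lq by (intro mult_nonneg_nonneg) auto
  note facts = real sign deg q0 lead conjunct2[OF lp]
  show "Im z > 0 \<Longrightarrow> Im (cpoly ?p z * cnj (cpoly ?q z)) > 0"
    by (rule interlacing_Im_pos[OF facts])
  show "poly (pderiv ?p) x * poly ?q x - poly ?p x * poly (pderiv ?q) x > 0"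
    by (rule interlacing_wronskian_pos[OF facts])
qed

lemma jacobi_Omega_pos:
  assumes "x \<ge> 0"
  shows "poly (jacobi_Omega m \<alpha> \<beta>) x > 0"
proof -
  have d: "poly ((pderiv ^^ (2 * k)) (jacobi_poly m \<alpha> \<beta>)) 1 > 0" if "k \<le> m div 2" for k
    using that by (intro higher_pderiv_jacobi_1_pos[OF admissible_gt[OF adm]]) auto
  show ?thesis
    unfolding jacobi_Omega_def poly_sum poly_monom
  proof (rule sum_pos2[of _ 0])
    fix k assume "k \<in> {..m div 2}"
    then show "poly ((pderiv ^^ (2 * k)) (jacobi_poly m \<alpha> \<beta>)) 1 * x ^ k \<ge> 0"
      using d[of k] assms by simp
  qed (use d[of 0] in simp_all)
qed

end

context
  fixes \<alpha> \<beta> :: real and n :: nat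
  assumes adm: "admissible \<alpha> \<beta>" and adm': "admissible \<beta> \<alpha>" and n: "n \<ge> 2"
begin


text \<open>The characteristic polynomial is ?Q ?Q' (?P / ?Q + ?P' / ?Q'), and both quotients have
  positive imaginary part at z.\<close>

lemma tau_char_poly_upper_nonzero:
  assumes z: "Im z > 0"
  shows "cpoly (tau_char_poly n \<alpha> \<beta>) z \<noteq> 0"
proof
  let ?P = "jacobi_Omega n \<alpha> \<beta>" and ?Q = "jacobi_Omega (n - 1) \<alpha> \<beta>"
    and ?P' = "jacobi_Omega n \<beta> \<alpha>" and ?Q' = "jacobi_Omega (n - 1) \<beta> \<alpha>"
  assume "cpoly (tau_char_poly n \<alpha> \<beta>) z = 0"
  then have B0: "cpoly ?P z * cpoly ?Q' z + cpoly ?P' z * cpoly ?Q z = 0"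
    by (simp add: tau_char_poly_def cpoly_simps)
  define a a' where "a = cpoly ?P z * cnj (cpoly ?Q z)" and "a' = cpoly ?P' z * cnj (cpoly ?Q' z)"
  have a: "Im a > 0" "Im a' > 0"
    unfolding a_def a'_def by (intro jacobi_Omega_Im_pos adm adm' n z)+
  then have q: "cpoly ?Q z \<noteq> 0" "cpoly ?Q' z \<noteq> 0" by (auto simp: a_def a'_def)
  have "0 = (cpoly ?P z * cpoly ?Q' z + cpoly ?P' z * cpoly ?Q z) * cnj (cpoly ?Q z * cpoly ?Q' z)"
    unfolding B0 by simp
  also have "\<dots> = a * (cpoly ?Q' z * cnj (cpoly ?Q' z)) + a' * (cpoly ?Q z * cnj (cpoly ?Q z))"
    by (simp add: a_def a'_def algebra_simps)
  also have "\<dots> = of_real ((cmod (cpoly ?Q' z))\<^sup>2) * a + of_real ((cmod (cpoly ?Q z))\<^sup>2) * a'"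
    by (simp only: complex_norm_square mult_ac)
  finally have "Im 0 = Im (of_real ((cmod (cpoly ?Q' z))\<^sup>2) * a + of_real ((cmod (cpoly ?Q z))\<^sup>2) * a')"
    by (rule arg_cong)
  then have "Im 0 = (cmod (cpoly ?Q' z))\<^sup>2 * Im a + (cmod (cpoly ?Q z))\<^sup>2 * Im a'"
    by (simp only: plus_complex.sel times_complex.sel Re_complex_of_real Im_complex_of_real mult_zero_left add_0_right)
  moreover have "(cmod (cpoly ?Q' z))\<^sup>2 * Im a + (cmod (cpoly ?Q z))\<^sup>2 * Im a' > 0"
    using a q by (intro add_pos_pos mult_pos_pos) auto
  ultimately show False by simp
qed

text \<open>Conjugation symmetry extends the previous lemma to the lower half plane, and positivity
  of all even parts on [0, \<infinity>) excludes nonnegative zeros. Simplicity comes from the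
  positive Wronskians, with a separate argument at a common zero of ?Q and ?Q'.\<close>

lemma tau_char_poly_root:
  assumes "cpoly (tau_char_poly n \<alpha> \<beta>) z = 0"
  shows "z \<in> \<real>" "Re z < 0" "cpoly (pderiv (tau_char_poly n \<alpha> \<beta>)) z \<noteq> 0"
proof -
  let ?P = "jacobi_Omega n \<alpha> \<beta>" and ?Q = "jacobi_Omega (n - 1) \<alpha> \<beta>"
    and ?P' = "jacobi_Omega n \<beta> \<alpha>" and ?Q' = "jacobi_Omega (n - 1) \<beta> \<alpha>"
  let ?B = "tau_char_poly n \<alpha> \<beta>"
  have "cpoly ?B (cnj z) = cnj (cpoly ?B z)"
    by (subst poly_cnj) (simp add: map_poly_map_poly o_def)
  then have "Im z = 0"
    using assms tau_char_poly_upper_nonzero[of z] tau_char_poly_upper_nonzero[of "cnj z"]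
    by (cases "Im z" "0 :: real" rule: linorder_cases) auto
  then obtain x where x: "z = of_real x" by (metis complex_is_Real_iff Reals_cases)
  then show "z \<in> \<real>" by simp
  have B: "poly ?B x = 0" using assms unfolding x cpoly_of_real by simp
  have "x < 0"
  proof (rule ccontr)
    assume "\<not> x < 0"
    then have "poly ?B x > 0"
      unfolding tau_char_poly_def poly_add poly_mult
      by (intro add_pos_pos mult_pos_pos jacobi_Omega_pos adm adm' n) auto
    with B show False by simp
  qed
  then show "Re z < 0" by (simp add: x)
  define p q p' q' where "p = poly ?P x" and "q = poly ?Q x" and "p' = poly ?P' x" and "q' = poly ?Q' x"
  define dp dq dp' dq' where "dp = poly (pderiv ?P) x" and "dq = poly (pderiv ?Q) x"
    and "dp' = poly (pderiv ?P') x" and "dq' = poly (pderiv ?Q') x"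
  note defs = p_def q_def p'_def q'_def dp_def dq_def dp'_def dq'_def
  have W: "dp * q - p * dq > 0" and W': "dp' * q' - p' * dq' > 0"
    unfolding defs by (intro jacobi_Omega_wronskian_pos adm adm' n)+
  have B0: "p * q' + p' * q = 0" using B by (simp add: tau_char_poly_def defs)
  have dB: "poly (pderiv ?B) x = dp * q' + p * dq' + dp' * q + p' * dq"
    by (simp add: tau_char_poly_def pderiv_add pderiv_mult defs algebra_simps)
  have "poly (pderiv ?B) x \<noteq> 0"
  proof
    assume 0: "poly (pderiv ?B) x = 0"
    \<comment> \<open>The two Wronskian terms form the numerator of the derivative of ?P / ?Q + ?P'
      / ?Q' = ?B / (?Q ?Q').\<close>
    have "q'\<^sup>2 * (dp * q - p * dq) + q\<^sup>2 * (dp' * q' - p' * dq')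
        = q * q' * (dp * q' + p * dq' + dp' * q + p' * dq) - (q' * dq + q * dq') * (p * q' + p' * q)"
      by (simp add: algebra_simps power2_eq_square)
    also have "\<dots> = 0" using 0 unfolding dB B0 by simp
    finally have "q'\<^sup>2 * (dp * q - p * dq) + q\<^sup>2 * (dp' * q' - p' * dq') = 0" .
    moreover have "q'\<^sup>2 * (dp * q - p * dq) \<ge> 0" "q\<^sup>2 * (dp' * q' - p' * dq') \<ge> 0"
      using W W' by simp_all
    ultimately have "q'\<^sup>2 * (dp * q - p * dq) = 0" "q\<^sup>2 * (dp' * q' - p' * dq') = 0" by linarith+
    then have q0: "q = 0" "q' = 0" using W W' by auto
    with W W' have s: "p * dq < 0" "p' * dq' < 0" by simp_all
    \<comment> \<open>At a common zero the derivative of ?B reduces to p dq' + p' dq. Multiplied by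
      dq dq' it becomes a sum of two negative terms, although it should vanish.\<close>
    have "dq'\<^sup>2 * (p * dq) + dq\<^sup>2 * (p' * dq') = dq * dq' * (p * dq' + p' * dq)"
      by (simp add: algebra_simps power2_eq_square)
    also have "\<dots> = 0" using 0 unfolding dB q0 by simp
    finally have "dq'\<^sup>2 * (p * dq) + dq\<^sup>2 * (p' * dq') = 0" .
    moreover have "dq \<noteq> 0" "dq' \<noteq> 0" using s by auto
    then have "dq'\<^sup>2 * (p * dq) < 0" "dq\<^sup>2 * (p' * dq') < 0"
      using s by (simp_all add: mult_pos_neg)
    ultimately show False by linarith
  qed
  then show "cpoly (pderiv ?B) z \<noteq> 0" unfolding x cpoly_of_real by simp
qed

lemma degree_tau_char_poly: "degree (tau_char_poly n \<alpha> \<beta>) = n - 1"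
proof -
  let ?P = "jacobi_Omega n \<alpha> \<beta>" and ?Q = "jacobi_Omega (n - 1) \<alpha> \<beta>"
    and ?P' = "jacobi_Omega n \<beta> \<alpha>" and ?Q' = "jacobi_Omega (n - 1) \<beta> \<alpha>"
  have d: "n div 2 + (n - 1) div 2 = n - 1" using n by presburger
  have nz: "jacobi_Omega m \<alpha> \<beta> \<noteq> 0" "jacobi_Omega m \<beta> \<alpha> \<noteq> 0" for m
    using jacobi_Omega_0_pos[OF adm, of m] jacobi_Omega_0_pos[OF adm', of m] by auto
  have deg: "degree (?P * ?Q') = n - 1" "degree (?P' * ?Q) = n - 1"
    using nz d by (simp_all add: degree_mult_eq degree_jacobi_Omega[OF adm] degree_jacobi_Omega[OF adm'])
  have lc: "lead_coeff (jacobi_Omega m \<alpha> \<beta>) > 0" "lead_coeff (jacobi_Omega m \<beta> \<alpha>) > 0" for m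
    using jacobi_Omega_coeff_pos[OF adm, of "m div 2" m] jacobi_Omega_coeff_pos[OF adm', of "m div 2" m]
    by (simp_all add: degree_jacobi_Omega[OF adm] degree_jacobi_Omega[OF adm'])
  have "lead_coeff (?P * ?Q') > 0" "lead_coeff (?P' * ?Q) > 0"
    unfolding lead_coeff_mult by (intro mult_pos_pos lc)+
  then have "coeff (tau_char_poly n \<alpha> \<beta>) (n - 1) > 0"
    unfolding deg tau_char_poly_def by simp
  then have "n - 1 \<le> degree (tau_char_poly n \<alpha> \<beta>)" by (intro le_degree) auto
  moreover have "degree (tau_char_poly n \<alpha> \<beta>) \<le> n - 1"
    unfolding tau_char_poly_def by (intro degree_add_le) (simp_all only: deg order.refl)
  ultimately show ?thesis by simp
qed

lemma rsquarefree_tau_char_poly: "rsquarefree (map_poly complex_of_real (tau_char_poly n \<alpha> \<beta>))"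
  unfolding rsquarefree_roots using tau_char_poly_root(3) by (auto simp flip: map_poly_of_real_pderiv)

lemma card_tau_char_poly_roots: "card {z. cpoly (tau_char_poly n \<alpha> \<beta>) z = 0} = n - 1"
  using card_roots_rsquarefree[OF rsquarefree_tau_char_poly]
  by (simp add: degree_map_poly degree_tau_char_poly)

end

section \<open>The Tau eigenvalue problem\<close>

lemma map_poly_Re_Im:
  "map_poly complex_of_real (map_poly Re p) + smult \<i> (map_poly complex_of_real (map_poly Im p)) = p"
  by (rule poly_eqI) (simp add: coeff_map_poly complex_eq_iff)

lemma poly_of_real_Re_Im:
  "poly p (of_real x) = of_real (poly (map_poly Re p) x) + \<i> * of_real (poly (map_poly Im p) x)"
proof -
  have "poly p (of_real x) = poly (map_poly complex_of_real (map_poly Re p)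
      + smult \<i> (map_poly complex_of_real (map_poly Im p))) (of_real x)"
    by (simp only: map_poly_Re_Im)
  then show ?thesis by (simp add: cpoly_of_real)
qed

lemma has_integral_complex_jacobi:
  assumes "\<alpha> > -1" "\<beta> > -1"
  shows "((\<lambda>x::real. poly p (of_real x) * of_real (jacobi_weight \<alpha> \<beta> x)) has_integral
    (of_real (jacobi_integral \<alpha> \<beta> (map_poly Re p)) + \<i> * of_real (jacobi_integral \<alpha> \<beta> (map_poly Im p)))) {-1<..<1}"
proof -
  have "((\<lambda>x::real. of_real (poly (map_poly Re p) x * jacobi_weight \<alpha> \<beta> x)
      + \<i> * of_real (poly (map_poly Im p) x * jacobi_weight \<alpha> \<beta> x) :: complex) has_integral
    (of_real (jacobi_integral \<alpha> \<beta> (map_poly Re p)) + \<i> * of_real (jacobi_integral \<alpha> \<beta> (map_poly Im p)))) {-1<..<1}"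
    by (intro has_integral_add has_integral_mult_right has_integral_of_real
        has_integral_jacobi_integral assms)
  then show ?thesis
    by (simp add: poly_of_real_Re_Im distrib_right mult.assoc)
qed

lemma has_integral_0_complex_jacobi_iff:
  assumes "\<alpha> > -1" "\<beta> > -1"
  shows "((\<lambda>x::real. poly f (of_real x) * poly p (of_real x) * of_real (jacobi_weight \<alpha> \<beta> x)) has_integral 0) {-1<..<1}
    \<longleftrightarrow> jacobi_integral \<alpha> \<beta> (map_poly Re (f * p)) = 0 \<and> jacobi_integral \<alpha> \<beta> (map_poly Im (f * p)) = 0"
    (is "?I \<longleftrightarrow> ?J")
proof -
  let ?c = "of_real (jacobi_integral \<alpha> \<beta> (map_poly Re (f * p))) + \<i> * of_real (jacobi_integral \<alpha> \<beta> (map_poly Im (f * p)))"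
  have H: "((\<lambda>x::real. poly f (of_real x) * poly p (of_real x) * of_real (jacobi_weight \<alpha> \<beta> x)) has_integral ?c) {-1<..<1}"
    using has_integral_complex_jacobi[OF assms, of "f * p"] by simp
  have "?I \<longleftrightarrow> ?c = 0"
  proof
    assume ?I
    then show "?c = 0" by (rule has_integral_unique[OF H])
  next
    assume "?c = 0"
    with H show ?I by (simp only:)
  qed
  also have "\<dots> \<longleftrightarrow> ?J" by (simp add: complex_eq_iff)
  finally show ?thesis .
qed

text \<open>Removing multiples of P_n and P_(n-1) brings the degree down to n - 2. The remainder is
  then an admissible test polynomial orthogonal to itself, hence 0.\<close>

lemma jacobi_span:
  assumes ab: "\<alpha> > -1" "\<beta> > -1" and n: "n \<ge> 2" and deg: "degree F \<le> n"
    and orth: "\<And>r. degree r \<le> n - 2 \<Longrightarrow> jacobi_integral \<alpha> \<beta> (F * r) = 0"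
  obtains a b where "F = smult a (jacobi_poly n \<alpha> \<beta>) + smult b (jacobi_poly (n - 1) \<alpha> \<beta>)"
proof -
  let ?P = "jacobi_poly n \<alpha> \<beta>" and ?Q = "jacobi_poly (n - 1) \<alpha> \<beta>"
  define a where "a = coeff F n / coeff ?P n"
  define G where "G = F - smult a ?P"
  define b where "b = coeff G (n - 1) / coeff ?Q (n - 1)"
  define H where "H = G - smult b ?Q"
  have "degree G \<le> n" "coeff G n = 0"
    using lead_coeff_jacobi_poly_pos[OF ab, of n] deg
    by (auto simp: G_def a_def degree_jacobi_poly ab intro!: degree_diff_le order.trans[OF degree_smult_le])
  then have dG: "degree G \<le> n - 1" using degree_less_or_0[of G n] by auto
  have "degree H \<le> n - 1" "coeff H (n - 1) = 0"
    using lead_coeff_jacobi_poly_pos[OF ab, of "n - 1"] dG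
    by (auto simp: H_def b_def degree_jacobi_poly ab intro!: degree_diff_le order.trans[OF degree_smult_le])
  then have dH: "degree H \<le> n - 2" using degree_less_or_0[of H "n - 1"] by auto
  have "jacobi_integral \<alpha> \<beta> (H * H) = jacobi_integral \<alpha> \<beta> (F * H)
      - a * jacobi_integral \<alpha> \<beta> (?P * H) - b * jacobi_integral \<alpha> \<beta> (?Q * H)"
    by (simp add: H_def[unfolded G_def] left_diff_distrib jacobi_integral_linear[OF ab])
  also have "\<dots> = 0"
    using orth[OF dH] jacobi_poly_orthogonal[OF ab, of H n] jacobi_poly_orthogonal[OF ab, of H "n - 1"] dH n
    by simp
  finally have "H = 0" using jacobi_integral_self_pos[OF ab, of H] by fastforce
  then show ?thesis by (intro that[of a b]) (simp add: H_def G_def)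
qed

lemma map_poly_Re_mult_of_real: "map_poly Re (f * map_poly complex_of_real r) = map_poly Re f * r"
  and map_poly_Im_mult_of_real: "map_poly Im (f * map_poly complex_of_real r) = map_poly Im f * r"
  by (rule poly_eqI; simp add: coeff_map_poly coeff_mult)+

text \<open>This yields the form with two tau terms. Real test polynomials separate the real and
  imaginary parts of f, and \<open>jacobi_span\<close> applies to each.\<close>

lemma tau_orthogonality_iff:
  assumes ab: "\<alpha> > -1" "\<beta> > -1" and n: "n \<ge> 2" and deg: "degree f \<le> n"
  shows "(\<forall>p :: complex poly. degree p \<le> n - 2 \<longrightarrow>
      ((\<lambda>x::real. poly f (of_real x) * poly p (of_real x) * of_real (jacobi_weight \<alpha> \<beta> x)) has_integral 0) {-1<..<1})
    \<longleftrightarrow> (\<exists>a b. f = smult a (map_poly of_real (jacobi_poly n \<alpha> \<beta>)) + smult b (map_poly of_real (jacobi_poly (n - 1) \<alpha> \<beta>)))"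
    (is "?L \<longleftrightarrow> ?R")
proof
  let ?P = "jacobi_poly n \<alpha> \<beta>" and ?Q = "jacobi_poly (n - 1) \<alpha> \<beta>"
  assume ?L
  have orth: "jacobi_integral \<alpha> \<beta> (map_poly Re f * r) = 0 \<and> jacobi_integral \<alpha> \<beta> (map_poly Im f * r) = 0"
    if "degree r \<le> n - 2" for r
    using \<open>?L\<close>[rule_format, of "map_poly of_real r"] that
    unfolding has_integral_0_complex_jacobi_iff[OF ab]
    by (simp add: map_poly_Re_mult_of_real map_poly_Im_mult_of_real degree_map_poly)
  have dR: "degree (map_poly Re f) \<le> n" and dI: "degree (map_poly Im f) \<le> n"
    using deg by (meson map_poly_degree_leq order.trans)+
  obtain a b where R: "map_poly Re f = smult a ?P + smult b ?Q"
    using jacobi_span[OF ab n dR] orth by blast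
  obtain a' b' where I: "map_poly Im f = smult a' ?P + smult b' ?Q"
    using jacobi_span[OF ab n dI] orth by blast
  have "f = smult (of_real a + \<i> * of_real a') (map_poly of_real ?P)
      + smult (of_real b + \<i> * of_real b') (map_poly of_real ?Q)"
    by (subst map_poly_Re_Im[of f, symmetric], unfold R I)
      (simp add: cpoly_simps smult_add_left smult_add_right algebra_simps)
  then show ?R by blast
next
  let ?P = "jacobi_poly n \<alpha> \<beta>" and ?Q = "jacobi_poly (n - 1) \<alpha> \<beta>"
  assume ?R
  then obtain a b where f: "f = smult a (map_poly of_real ?P) + smult b (map_poly of_real ?Q)" by blast
  show ?L
  proof (intro allI impI)
    fix p :: "complex poly" assume p: "degree p \<le> n - 2"
    have deg: "degree (map_poly g p) < n - 1" for g :: "complex \<Rightarrow> real"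
      using p n map_poly_degree_leq[of g p] by linarith
    have orth: "jacobi_integral \<alpha> \<beta> (?P * map_poly g p) = 0" "jacobi_integral \<alpha> \<beta> (?Q * map_poly g p) = 0" for g
      using deg[of g] by (intro jacobi_poly_orthogonal ab; simp)+
    have Re: "map_poly Re (f * p) = smult (Re a) (?P * map_poly Re p) - smult (Im a) (?P * map_poly Im p)
        + smult (Re b) (?Q * map_poly Re p) - smult (Im b) (?Q * map_poly Im p)"
      unfolding f by (rule poly_eqI)
        (simp add: coeff_map_poly coeff_mult sum_distrib_left sum_subtractf sum.distrib algebra_simps)
    have Im: "map_poly Im (f * p) = smult (Re a) (?P * map_poly Im p) + smult (Im a) (?P * map_poly Re p)
        + smult (Re b) (?Q * map_poly Im p) + smult (Im b) (?Q * map_poly Re p)"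
      unfolding f by (rule poly_eqI)
        (simp add: coeff_map_poly coeff_mult sum_distrib_left sum_subtractf sum.distrib algebra_simps)
    show "((\<lambda>x::real. poly f (of_real x) * poly p (of_real x) * of_real (jacobi_weight \<alpha> \<beta> x)) has_integral 0) {-1<..<1}"
      unfolding has_integral_0_complex_jacobi_iff[OF ab] Re Im
      by (simp add: jacobi_integral_linear[OF ab] orth del: One_nat_def)
  qed
qed

section \<open>The inverse of 1 - \<mu> D^2 on polynomials\<close>

definition even_resolvent :: "complex \<Rightarrow> nat \<Rightarrow> complex poly \<Rightarrow> complex poly" where
  "even_resolvent \<mu> n f = (\<Sum>k\<le>n. smult (\<mu> ^ k) ((pderiv ^^ (2 * k)) f))"

lemma even_resolvent_add: "even_resolvent \<mu> n (f + g) = even_resolvent \<mu> n f + even_resolvent \<mu> n g"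
  by (simp add: even_resolvent_def higher_pderiv_add smult_add_right sum.distrib)

lemma even_resolvent_smult: "even_resolvent \<mu> n (smult c f) = smult c (even_resolvent \<mu> n f)"
  by (induction n) (simp_all add: even_resolvent_def higher_pderiv_smult smult_add_right mult.commute)

lemma even_resolvent_pderiv2:
  "even_resolvent \<mu> n (pderiv (pderiv f)) = pderiv (pderiv (even_resolvent \<mu> n f))"
proof -
  have "(pderiv ^^ k) (pderiv (pderiv f)) = pderiv (pderiv ((pderiv ^^ k) f))" for k
    by (simp add: funpow_swap1)
  then show ?thesis
    by (induction n) (simp_all add: even_resolvent_def pderiv_add pderiv_smult)
qed

text \<open>The Neumann series in \<mu> D^2 telescopes, and its remainder is a derivative of order 2
  n + 2, which vanishes on degree at most n.\<close>

lemma even_resolvent_eq: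
  assumes "degree f \<le> n"
  shows "even_resolvent \<mu> n f - smult \<mu> (pderiv (pderiv (even_resolvent \<mu> n f))) = f"
proof -
  have "(pderiv ^^ (2 * Suc n)) f = 0"
    using assms by (intro higher_pderiv_degree_less) simp
  moreover have "even_resolvent \<mu> m f - smult \<mu> (pderiv (pderiv (even_resolvent \<mu> m f)))
      = f - smult (\<mu> ^ Suc m) ((pderiv ^^ (2 * Suc m)) f)" for m
  proof (induction m)
    case (Suc m)
    let ?E = "even_resolvent \<mu> m f" and ?D = "(pderiv ^^ (2 * Suc m)) f"
    have E: "even_resolvent \<mu> (Suc m) f = ?E + smult (\<mu> ^ Suc m) ?D"
      by (simp add: even_resolvent_def)
    have D: "(pderiv ^^ (2 * Suc (Suc m))) f = pderiv (pderiv ?D)" by simp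
    show ?case
      unfolding E D pderiv_add pderiv_smult smult_add_right smult_smult
      using Suc by (simp add: algebra_simps del: funpow.simps power_Suc) (simp add: algebra_simps)
  qed (simp add: even_resolvent_def numeral_2_eq_2)
  ultimately show ?thesis by simp
qed

lemma even_resolvent_unique:
  assumes "degree u \<le> n"
  shows "even_resolvent \<mu> n (u - smult \<mu> (pderiv (pderiv u))) = u"
  using even_resolvent_eq[OF assms, of \<mu>]
    even_resolvent_add[of \<mu> n u "smult (- \<mu>) (pderiv (pderiv u))"]
    even_resolvent_smult[of \<mu> n "- \<mu>" "pderiv (pderiv u)"]
  by (simp add: even_resolvent_pderiv2)

lemma higher_pderiv_of_real:
  "(pderiv ^^ k) (map_poly complex_of_real p) = map_poly complex_of_real ((pderiv ^^ k) p)"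
  by (induction k) (simp_all add: map_poly_of_real_pderiv)

text \<open>These are the boundary values in the Tau problem. At -1 the reflection formula swaps the
  parameters, and the sign is (-1)^m because only even derivatives occur.\<close>

lemma even_resolvent_jacobi:
  assumes ab: "\<alpha> > -1" "\<beta> > -1" and m: "m \<le> n"
  shows "poly (even_resolvent \<mu> n (map_poly of_real (jacobi_poly m \<alpha> \<beta>))) 1 = cpoly (jacobi_Omega m \<alpha> \<beta>) \<mu>"
    and "poly (even_resolvent \<mu> n (map_poly of_real (jacobi_poly m \<alpha> \<beta>))) (-1) = (-1) ^ m * cpoly (jacobi_Omega m \<beta> \<alpha>) \<mu>"
proof -
  have expand: "cpoly (jacobi_Omega m a b) \<mu> = (\<Sum>k\<le>n. \<mu> ^ k * of_real (poly ((pderiv ^^ (2 * k)) (jacobi_poly m a b)) 1))"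
    if "a > -1" "b > -1" for a b
  proof -
    have "(pderiv ^^ (2 * k)) (jacobi_poly m a b) = 0" if "\<not> k \<le> m div 2" for k
      using that \<open>a > -1\<close> \<open>b > -1\<close> by (intro higher_pderiv_degree_less) (auto simp: degree_jacobi_poly)
    then show ?thesis
      unfolding jacobi_Omega_def cpoly_sum_monom using m
      by (intro sum.mono_neutral_cong_left) (auto simp: mult.commute)
  qed
  have val: "poly (even_resolvent \<mu> n (map_poly of_real (jacobi_poly m \<alpha> \<beta>))) (of_real x)
      = (\<Sum>k\<le>n. \<mu> ^ k * of_real (poly ((pderiv ^^ (2 * k)) (jacobi_poly m \<alpha> \<beta>)) x))" for x
    by (simp add: even_resolvent_def poly_sum higher_pderiv_of_real cpoly_of_real)
  show "poly (even_resolvent \<mu> n (map_poly of_real (jacobi_poly m \<alpha> \<beta>))) 1 = cpoly (jacobi_Omega m \<alpha> \<beta>) \<mu>"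
    using val[of 1] by (simp add: expand ab)
  show "poly (even_resolvent \<mu> n (map_poly of_real (jacobi_poly m \<alpha> \<beta>))) (-1) = (-1) ^ m * cpoly (jacobi_Omega m \<beta> \<alpha>) \<mu>"
    using val[of "-1"]
    by (simp add: expand ab poly_higher_pderiv_jacobi_minus power_add sum_distrib_left mult.left_commute)
qed

text \<open>With \<mu> = 1 / lam, a solution u is the even resolvent of a combination a P_n + b
  P_(n-1). The boundary conditions become a homogeneous linear system for a and b, whose determinant
  is minus the characteristic polynomial at \<mu>.\<close>

lemma tau_eigenvalue_iff:
  assumes ab: "\<alpha> > -1" "\<beta> > -1" and n: "n \<ge> 2"
  shows "tau_eigenvalue n \<alpha> \<beta> lam \<longleftrightarrow> lam \<noteq> 0 \<and> cpoly (tau_char_poly n \<alpha> \<beta>) (1 / lam) = 0"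
proof -
  let ?P = "map_poly complex_of_real (jacobi_poly n \<alpha> \<beta>)" and ?Q = "map_poly complex_of_real (jacobi_poly (n - 1) \<alpha> \<beta>)"
  define \<mu> where "\<mu> = 1 / lam"
  define p q p' q' where "p = cpoly (jacobi_Omega n \<alpha> \<beta>) \<mu>" and "q = cpoly (jacobi_Omega (n - 1) \<alpha> \<beta>) \<mu>"
    and "p' = cpoly (jacobi_Omega n \<beta> \<alpha>) \<mu>" and "q' = cpoly (jacobi_Omega (n - 1) \<beta> \<alpha>) \<mu>"
  have B: "cpoly (tau_char_poly n \<alpha> \<beta>) \<mu> = p * q' + p' * q"
    by (simp add: tau_char_poly_def cpoly_simps p_def q_def p'_def q'_def)
  have degP: "degree ?P = n" and degQ: "degree ?Q = n - 1"
    by (simp_all add: degree_map_poly degree_jacobi_poly ab)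
  have lcP: "coeff ?P n \<noteq> 0" and lcQ: "coeff ?Q (n - 1) \<noteq> 0"
    using lead_coeff_jacobi_poly_pos[OF ab, of n] lead_coeff_jacobi_poly_pos[OF ab, of "n - 1"]
    by (simp_all add: coeff_map_poly)
  \<comment> \<open>P_n and P_(n-1) have different degrees, so a nontrivial combination has degree
    at least n - 1.\<close>
  have comb0: "a = 0 \<and> b = 0" if "degree (smult a ?P + smult b ?Q) < n - 1 \<or> smult a ?P + smult b ?Q = 0" for a b
  proof -
    have z: "coeff (smult a ?P + smult b ?Q) k = 0" if "k \<ge> n - 1" for k
      using \<open>degree (smult a ?P + smult b ?Q) < n - 1 \<or> smult a ?P + smult b ?Q = 0\<close> that
      by (elim disjE) (simp_all only: coeff_0, intro coeff_eq_0, simp)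
    have "coeff ?Q n = 0" using degQ n by (intro coeff_eq_0) simp
    with z[of n] lcP have "a = 0" by simp
    with z[of "n - 1"] lcQ show ?thesis by simp
  qed
  define U where "U a b = even_resolvent \<mu> n (smult a ?P + smult b ?Q)" for a b
  have U1: "poly (U a b) 1 = a * p + b * q" for a b
    by (simp add: U_def even_resolvent_add even_resolvent_smult even_resolvent_jacobi ab p_def q_def)
  \<comment> \<open>The minus sign comes from (-1)^(n-1) = -(-1)^n.\<close>
  have Um1: "poly (U a b) (-1) = (-1) ^ n * (a * p' - b * q')" for a b
    using n by (simp add: U_def even_resolvent_add even_resolvent_smult even_resolvent_jacobi ab p'_def q'_def
        power_diff algebra_simps)
  have degL: "degree (smult lam u - pderiv (pderiv u)) \<le> n" if "degree u \<le> n" for u :: "complex poly"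
    using that by (intro degree_diff_le order.trans[OF degree_smult_le]) (auto simp: degree_pderiv)
  have eig: "tau_eigenvalue n \<alpha> \<beta> lam \<longleftrightarrow> (\<exists>u. u \<noteq> 0 \<and> degree u \<le> n \<and> poly u 1 = 0 \<and> poly u (-1) = 0 \<and>
      (\<exists>a b. smult lam u - pderiv (pderiv u) = smult a ?P + smult b ?Q))"
    unfolding tau_eigenvalue_def
    by (intro ex_cong1 conj_cong refl tau_orthogonality_iff[OF ab n degL])
  show ?thesis
  proof
    assume "tau_eigenvalue n \<alpha> \<beta> lam"
    then obtain u a b where u: "u \<noteq> 0" "degree u \<le> n" "poly u 1 = 0" "poly u (-1) = 0"
      and eq: "smult lam u - pderiv (pderiv u) = smult a ?P + smult b ?Q"
      unfolding eig by blast
    \<comment> \<open>For lam = 0 the combination would equal -u'', of degree at most n - 2, hence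
      be 0; then u is linear with two zeros.\<close>
    have lam: "lam \<noteq> 0"
    proof
      assume "lam = 0"
      then have eq0: "- pderiv (pderiv u) = smult a ?P + smult b ?Q" using eq by simp
      have "degree (- pderiv (pderiv u)) \<le> n - 2" using u(2) by (simp add: degree_pderiv)
      then have "a = 0 \<and> b = 0" using n comb0[of a b] unfolding eq0 by linarith
      with eq0 have "pderiv (pderiv u) = 0" by simp
      then have "degree u < 2" by (simp add: pderiv_eq_0_iff degree_pderiv)
      then have "u = 0" using u(3,4) by (intro poly_eqI_degree[of "{1, -1}"]) auto
      with u(1) show False by simp
    qed
    have "u - smult \<mu> (pderiv (pderiv u)) = smult \<mu> (smult lam u - pderiv (pderiv u))"
      using lam by (simp add: smult_diff_right \<mu>_def)
    also have "\<dots> = smult (\<mu> * a) ?P + smult (\<mu> * b) ?Q" by (simp add: eq smult_add_right)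
    finally have uU: "u = U (\<mu> * a) (\<mu> * b)"
      using even_resolvent_unique[OF u(2), of \<mu>] by (simp add: U_def)
    define a' b' where "a' = \<mu> * a" and "b' = \<mu> * b"
    have e1: "a' * p + b' * q = 0" and e2: "a' * p' - b' * q' = 0"
      using u(3,4) unfolding uU U1 Um1 a'_def b'_def by simp_all
    have "a' \<noteq> 0 \<or> b' \<noteq> 0"
      using u(1) uU by (auto simp: a'_def b'_def U_def even_resolvent_def)
    \<comment> \<open>Cramer's rule: the determinant annihilates both unknowns.\<close>
    moreover have "a' * (p * q' + p' * q) = q' * (a' * p + b' * q) + q * (a' * p' - b' * q')"
      "b' * (p * q' + p' * q) = p' * (a' * p + b' * q) - p * (a' * p' - b' * q')"
      by (simp_all add: algebra_simps)
    ultimately have "p * q' + p' * q = 0" unfolding e1 e2 by auto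
    then show "lam \<noteq> 0 \<and> cpoly (tau_char_poly n \<alpha> \<beta>) (1 / lam) = 0"
      using lam B by (simp add: \<mu>_def)
  next
    assume "lam \<noteq> 0 \<and> cpoly (tau_char_poly n \<alpha> \<beta>) (1 / lam) = 0"
    then have lam: "lam \<noteq> 0" and B0: "p * q' + p' * q = 0" using B by (simp_all add: \<mu>_def)
    \<comment> \<open>A kernel vector of the singular system is read off from a nonzero row, (q, -p)
      or (q', p'); if both rows vanish, any vector serves.\<close>
    have "\<exists>a b. (a \<noteq> 0 \<or> b \<noteq> 0) \<and> a * p + b * q = 0 \<and> a * p' - b * q' = 0"
    proof -
      consider "p \<noteq> 0 \<or> q \<noteq> 0" | "p = 0" "q = 0" "p' \<noteq> 0 \<or> q' \<noteq> 0" | "p = 0" "q = 0" "p' = 0" "q' = 0"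
        by blast
      then show ?thesis
      proof cases
        case 1
        then show ?thesis using B0 by (intro exI[of _ q] exI[of _ "- p"]) (auto simp: algebra_simps)
      next
        case 2
        then show ?thesis by (intro exI[of _ q'] exI[of _ p']) auto
      next
        case 3
        then show ?thesis by (intro exI[of _ 1]) auto
      qed
    qed
    then obtain a b where nz: "a \<noteq> 0 \<or> b \<noteq> 0" and e: "a * p + b * q = 0" "a * p' - b * q' = 0" by blast
    have dc: "degree (smult a ?P + smult b ?Q) \<le> n"
      using degP degQ by (intro degree_add_le order.trans[OF degree_smult_le]) auto
    have sol: "U a b - smult \<mu> (pderiv (pderiv (U a b))) = smult a ?P + smult b ?Q"
      unfolding U_def by (rule even_resolvent_eq[OF dc])
    have "U a b \<noteq> 0"
    proof
      assume "U a b = 0"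
      with sol have "smult a ?P + smult b ?Q = 0" by simp
      with comb0[of a b] nz show False by blast
    qed
    moreover have "degree (U a b) \<le> n"
      unfolding U_def even_resolvent_def
      by (intro degree_sum_le order.trans[OF degree_smult_le]) (use dc in \<open>auto simp: degree_higher_pderiv\<close>)
    moreover have "smult lam (U a b) - pderiv (pderiv (U a b)) = smult (lam * a) ?P + smult (lam * b) ?Q"
      using arg_cong[OF sol, of "smult lam"] lam by (simp add: smult_diff_right smult_add_right \<mu>_def)
    ultimately show "tau_eigenvalue n \<alpha> \<beta> lam"
      unfolding eig using U1[of a b] Um1[of a b] e by (intro exI[of _ "U a b"]) auto
  qed
qed

theorem theorem3p12:
  fixes \<alpha> \<beta> :: real and n :: nat
  assumes range: "(-1 < \<alpha> \<and> \<alpha> \<le> 0 \<and> -1 < \<beta> \<and> \<beta> \<le> 0) \<or> (0 < \<alpha> \<and> \<alpha> \<le> 1 \<and> 0 < \<beta> \<and> \<beta> \<le> 1)"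
    and n: "n \<ge> 2"
  shows "(\<forall>lam. tau_eigenvalue n \<alpha> \<beta> lam \<longrightarrow> lam \<in> \<real> \<and> Re lam < 0) \<and>
         card {lam. tau_eigenvalue n \<alpha> \<beta> lam} = n - 1 \<and>
         (\<forall>lam. tau_eigenvalue n \<alpha> \<beta> lam \<longleftrightarrow>
                lam \<noteq> 0 \<and> poly (map_poly complex_of_real (tau_char_poly n \<alpha> \<beta>)) (1 / lam) = 0) \<and>
         (\<forall>\<mu>. poly (map_poly complex_of_real (tau_char_poly n \<alpha> \<beta>)) \<mu> = 0 \<longrightarrow>
                \<mu> \<in> \<real> \<and> Re \<mu> < 0 \<and>
                order \<mu> (map_poly complex_of_real (tau_char_poly n \<alpha> \<beta>)) = 1)"
proof -
  let ?B = "map_poly complex_of_real (tau_char_poly n \<alpha> \<beta>)"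
  have adm: "admissible \<alpha> \<beta>" "admissible \<beta> \<alpha>" using range by (auto simp: admissible_def)
  note iff = tau_eigenvalue_iff[OF admissible_gt[OF adm(1)] n]
  have root: "z \<in> \<real>" "Re z < 0" if "poly ?B z = 0" for z
    using tau_char_poly_root[OF adm n that] by auto
  have neg: "lam \<in> \<real> \<and> Re lam < 0" if "tau_eigenvalue n \<alpha> \<beta> lam" for lam
  proof -
    have "poly ?B (1 / lam) = 0" using that by (simp only: iff)
    note r = root[OF this]
    from r(1) obtain x where x: "1 / lam = of_real x" by (rule Reals_cases)
    with r(2) have "x < 0" by simp
    from arg_cong[OF x, of inverse] have "lam = of_real (1 / x)" by (simp add: inverse_eq_divide)
    with \<open>x < 0\<close> show ?thesis by simp
  qed
  \<comment> \<open>Since 0 is not a root, the default value 1 / 0 = 0 never appears, and inversion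
    matches roots with eigenvalues.\<close>
  have "{lam. tau_eigenvalue n \<alpha> \<beta> lam} = (\<lambda>z. 1 / z) ` {z. poly ?B z = 0}"
  proof (intro equalityI subsetI)
    fix lam assume "lam \<in> {lam. tau_eigenvalue n \<alpha> \<beta> lam}"
    then show "lam \<in> (\<lambda>z. 1 / z) ` {z. poly ?B z = 0}"
      by (intro image_eqI[of _ _ "1 / lam"]) (auto simp: iff)
  next
    fix lam assume "lam \<in> (\<lambda>z. 1 / z) ` {z. poly ?B z = 0}"
    then show "lam \<in> {lam. tau_eigenvalue n \<alpha> \<beta> lam}"
      using root(2)[of 0] by (auto simp: iff)
  qed
  then have card: "card {lam. tau_eigenvalue n \<alpha> \<beta> lam} = n - 1"
    by (simp add: card_image inj_on_def card_tau_char_poly_roots[OF adm n])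
  have "order z ?B = 1" if "poly ?B z = 0" for z
  proof -
    have sq: "rsquarefree ?B" by (rule rsquarefree_tau_char_poly[OF adm n])
    then have "?B \<noteq> 0" by (simp add: rsquarefree_def)
    with sq that show ?thesis by (intro rsquarefree_root_order)
  qed
  with neg card iff root show ?thesis by blast
qed

end
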